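(* Let $s\ge 0$ be an integer and let $a,b_1,c_1,\dots,b_{s+1},c_{s+1}$ be complex numbers. Then $$\begin{aligned}&{}_{2s+4}F_{2s+3}\left[\begin{matrix}a,\ 1+a/2,\ b_1,\ c_1,\ \ldots,\ b_{s+1},\ c_{s+1}\\ a/2,\ 1+a-b_1,\ 1+a-c_1,\ \ldots,\ 1+a-b_{s+1},\ 1+a-c_{s+1}\end{matrix}\,;\,-1\right]\\ &=\frac{\Gamma(1+a-b_{s+1})\Gamma(1+a-c_{s+1})}{\Gamma(1+a)\Gamma(1+a-b_{s+1}-c_{s+1})}\sum_{k_1,k_2,\ldots,k_s\ge0}\ \prod_{j=1}^s\frac{(1+a-b_j-c_j)_{k_j}\,(b_{j+1})_{k_1+\cdots+k_j}\,(c_{j+1})_{k_1+\cdots+k_j}}{k_j!\,(1+a-b_j)_{k_1+\cdots+k_j}\,(1+a-c_j)_{k_1+\cdots+k_j}},\end{aligned}$$ whenever the left-hand side is convergent.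
   Context: The Pochhammer symbol is $(x)_n=x(x+1)\cdots(x+n-1)=\Gamma(x+n)/\Gamma(x)$, with $(x)_0=1$. The generalized hypergeometric function is $${}_pF_q\left[\begin{matrix}a_1,\ldots,a_p\\ b_1,\ldots,b_q\end{matrix}\,;\,x\right]=\sum_{n=0}^\infty\frac{(a_1)_n\cdots(a_p)_n}{(b_1)_n\cdots(b_q)_n}\frac{x^n}{n!},$$ where no lower parameter $b_i$ is zero or a negative integer. When $s=0$ the sum over $k_1,\dots,k_s$ (with empty product) is understood to be $1$.
   Formalization: The formal theorem also assumes that the multiple sum on the right converges (as an unordered, i.e. absolutely convergent, sum); convergence of the left-hand side alone does not imply this, e.g. s=1, a=1, b_1=-2.3, c_1=-2.6, b_2=1.5, c_2=1.6. *)

theory Defs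
  imports "HOL-Analysis.Analysis"
begin

text \<open>
  The generalized hypergeometric function as an analytic series; the constant
  \<open>fps_hypergeo\<close> of the library is the corresponding formal power series. The lists
  hold the upper and the lower parameters.
\<close>

definition hypergeo_term :: "complex list \<Rightarrow> complex list \<Rightarrow> complex \<Rightarrow> nat \<Rightarrow> complex" where
  "hypergeo_term as bs x n =
     (\<Prod>a\<leftarrow>as. pochhammer a n) / (\<Prod>b\<leftarrow>bs. pochhammer b n) * (x ^ n / fact n)"

definition hypergeo :: "complex list \<Rightarrow> complex list \<Rightarrow> complex \<Rightarrow> complex" where
  "hypergeo as bs x = (\<Sum>n. hypergeo_term as bs x n)"

text \<open>Division by zero is total, so admissibility of the lower parameters is part of convergence.\<close>

definition hypergeo_convergent :: "complex list \<Rightarrow> complex list \<Rightarrow> complex \<Rightarrow> bool" where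
  "hypergeo_convergent as bs x \<longleftrightarrow>
     (\<forall>b\<in>set bs. b \<notin> \<int>\<^sub>\<le>\<^sub>0) \<and> summable (hypergeo_term as bs x)"

definition vwp_upper :: "nat \<Rightarrow> complex \<Rightarrow> (nat \<Rightarrow> complex) \<Rightarrow> (nat \<Rightarrow> complex) \<Rightarrow> complex list" where
  "vwp_upper s a b c = [a, 1 + a/2] @ concat (map (\<lambda>j. [b j, c j]) [1..<s+2])"

definition vwp_lower :: "nat \<Rightarrow> complex \<Rightarrow> (nat \<Rightarrow> complex) \<Rightarrow> (nat \<Rightarrow> complex) \<Rightarrow> complex list" where
  "vwp_lower s a b c = [a/2] @ concat (map (\<lambda>j. [1 + a - b j, 1 + a - c j]) [1..<s+2])"

definition multisum_term ::
  "nat \<Rightarrow> complex \<Rightarrow> (nat \<Rightarrow> complex) \<Rightarrow> (nat \<Rightarrow> complex) \<Rightarrow> (nat \<Rightarrow> nat) \<Rightarrow> complex" where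
  "multisum_term s a b c k =
     (\<Prod>j=1..s.
        (pochhammer (1 + a - b j - c j) (k j)
           * pochhammer (b (j+1)) (\<Sum>i=1..j. k i) * pochhammer (c (j+1)) (\<Sum>i=1..j. k i))
        / (fact (k j)
           * pochhammer (1 + a - b j) (\<Sum>i=1..j. k i) * pochhammer (1 + a - c j) (\<Sum>i=1..j. k i)))"

text \<open>
  The tuples \<open>(k\<^sub>1, \<dots>, k\<^sub>s)\<close>. For \<open>s = 0\<close> there is exactly one, the empty tuple, and
  the multiple sum is \<open>1\<close>.
\<close>

definition multi_indices :: "nat \<Rightarrow> (nat \<Rightarrow> nat) set" where
  "multi_indices s = {1..s} \<rightarrow>\<^sub>E UNIV"

end

theory Submission
  imports Defs "HOL-Complex_Analysis.Complex_Analysis"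
begin

text \<open>
  The proof iterates Bailey's lemma. If \<open>\<beta>\<^sub>n = (\<Sum>r\<le>n. \<alpha>\<^sub>r / ((n - r)! \<Gamma>(1 + a + n + r)))\<close>, then the
  Pfaff--Saalschuetz summation turns \<open>(\<alpha>, \<beta>)\<close> into another such pair, in which \<open>\<alpha>\<^sub>r\<close> is multiplied by
  \<open>(b)\<^sub>r (c)\<^sub>r / ((1 + a - b)\<^sub>r (1 + a - c)\<^sub>r)\<close> and \<open>\<beta>\<close> becomes a finite sum over the old \<open>\<beta>\<close>. Starting
  from the unit pair, where \<open>\<beta>\<^sub>n = 0\<close> for \<open>n > 0\<close>, the steps \<open>1, \<dots>, s\<close> build up the multiple sum by
  levels \<open>k\<^sub>1 + \<dots> + k\<^sub>s = n\<close>.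

  In step \<open>s + 1\<close> one lets \<open>n\<close> tend to infinity in the finite identity. With \<open>b\<close>, \<open>c\<close> the last two
  parameters, the \<open>\<alpha>\<close> side converges to the conditionally convergent series because its weights have
  uniformly bounded variation, but the \<open>\<beta>\<close> side is dominated only if \<open>Re (1 + a - b - c) \<ge> 1\<close>. In
  general one replaces \<open>c\<close> by \<open>c - t\<close>: both sides are analytic for \<open>Re t > 0\<close>, they agree for large
  \<open>Re t\<close>, and the limit \<open>t \<rightarrow> 0\<close> along the positive reals gives the claim, by the same bounded
  variation argument.
\<close>

section \<open>Bailey pairs and their finite transformation\<close>

lemma Suc_times_binomial_Suc: "Suc i * (m choose Suc i) = (m - i) * (m choose i)"
  by (metis binomial_absorb_comp binomial_absorption mult.commute)

text \<open>This is the Pfaff-Saalschuetz sum of a terminating balanced 3F2 at 1, multiplied by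
  \<open>pochhammer e m * pochhammer (e - b - c) m\<close>. Clearing the denominators turns it into
  a polynomial identity, so no parameter values have to be excluded. The proof is an induction on
  \<open>m\<close> by creative telescoping.\<close>

lemma pfaff_saalschuetz:
  fixes b c e :: "'a::comm_ring_1"
  shows "(\<Sum>i\<le>m. of_nat (m choose i) * pochhammer b i * pochhammer c i
            * pochhammer (e - b - c) (m - i) * pochhammer (e + of_nat i) (m - i))
         = pochhammer (e - b) m * pochhammer (e - c) m"
proof (induction m)
  case 0
  show ?case by simp
next
  case (Suc m)
  define d where "d = e - b - c"
  define t where "t = (\<lambda>i. of_nat (m choose i) * pochhammer b i * pochhammer c i
            * pochhammer d (m - i) * pochhammer (e + of_nat i) (m - i))"
  define X where "X = (\<lambda>i. pochhammer b i * pochhammer c i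
            * pochhammer d (Suc m - i) * pochhammer (e + of_nat i) (Suc m - i))"
  \<comment> \<open>Zeilberger's certificate: the recurrence in \<open>m\<close> holds termwise up to a difference of \<open>G\<close>.\<close>
  define G where "G = (\<lambda>i. of_nat i * (d + of_nat m - of_nat i) * t i)"
  have step: "of_nat (m choose i) * (X i + X (Suc i))
      = (e - b + of_nat m) * (e - c + of_nat m) * t i + (G (Suc i) - G i)" if "i \<le> m" for i
  \<comment> \<open>The boundary case is separate: at \<open>i = m\<close> the next term
    \<open>t (Suc m)\<close> vanishes through its binomial coefficient, while for smaller
    \<open>i\<close> one can write \<open>m - i = Suc k\<close> and peel factors off all the
    Pochhammer symbols.\<close>
  proof (cases "i = m")
    case True
    define K where "K = pochhammer b m * pochhammer c m"
    have "X m = K * (d * (e + of_nat m))" "X (Suc m) = K * ((b + of_nat m) * (c + of_nat m))"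
      by (simp_all add: X_def K_def pochhammer_Suc mult_ac)
    moreover have "t m = K" "t (Suc m) = 0"
      by (simp_all add: t_def K_def binomial_eq_0)
    moreover have "d * (e + of_nat m) + (b + of_nat m) * (c + of_nat m)
        = (e - b + of_nat m) * (e - c + of_nat m) - of_nat m * d"
      unfolding d_def by (simp add: algebra_simps)
    ultimately show ?thesis
      unfolding True G_def by (simp add: mult_ac flip: distrib_left) (simp add: algebra_simps)
  next
    case False
    with that obtain k where m: "m = i + Suc k"
      using less_imp_Suc_add by (metis add_Suc_right le_neq_implies_less)
    have mi: "m - i = Suc k" by (simp add: m)
    define B where "B = (of_nat (m choose i) :: 'a)"
    define B' where "B' = (of_nat (m choose Suc i) :: 'a)"
    have "of_nat (Suc i * (m choose Suc i)) = (of_nat ((m - i) * (m choose i)) :: 'a)"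
      by (simp only: Suc_times_binomial_Suc)
    then have B: "(1 + of_nat i) * B' = (1 + of_nat k) * B"
      unfolding mi by (simp add: B_def B'_def distrib_right)
    define P Q D E where "P = pochhammer b i" "Q = pochhammer c i" "D = pochhammer d k"
      "E = pochhammer (e + of_nat i + 1) k"
    have E1: "pochhammer (e + of_nat i) (Suc k) = (e + of_nat i) * E"
      by (simp add: pochhammer_rec P_Q_D_E_def)
    have E2: "pochhammer (e + of_nat i + 1) (Suc k) = E * (e + of_nat i + 1 + of_nat k)"
      by (simp add: pochhammer_Suc P_Q_D_E_def)
    have Xi: "X i = P * Q * (D * (d + of_nat k) * (d + 1 + of_nat k))
        * ((e + of_nat i) * (E * (e + of_nat i + 1 + of_nat k)))"
    proof -
      have "Suc m - i = Suc (Suc k)" by (simp add: m)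
      moreover have "pochhammer (e + of_nat i) (Suc (Suc k)) = (e + of_nat i) * (E * (e + of_nat i + 1 + of_nat k))"
        by (subst pochhammer_rec) (simp only: E2)
      ultimately show ?thesis
        by (simp add: X_def P_Q_D_E_def pochhammer_Suc mult_ac add_ac)
    qed
    have XS: "X (Suc i) = P * (b + of_nat i) * (Q * (c + of_nat i)) * (D * (d + of_nat k))
        * (E * (e + of_nat i + 1 + of_nat k))"
    proof -
      have "Suc m - Suc i = Suc k" by (simp add: m)
      moreover have "e + of_nat (Suc i) = e + of_nat i + 1" by simp
      ultimately show ?thesis
        unfolding X_def by (simp only: E2) (simp add: P_Q_D_E_def pochhammer_Suc mult_ac)
    qed
    have ti: "t i = B * P * Q * (D * (d + of_nat k)) * ((e + of_nat i) * E)"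
    proof -
      have "m - i = Suc k" by (simp add: m)
      then show ?thesis
        unfolding t_def by (simp only: E1) (simp add: P_Q_D_E_def B_def pochhammer_Suc mult_ac)
    qed
    have tS: "t (Suc i) = B' * (P * (b + of_nat i)) * (Q * (c + of_nat i)) * D * E"
    proof -
      have "m - Suc i = k" by (simp add: m)
      moreover have "e + of_nat (Suc i) = e + of_nat i + 1" by simp
      ultimately show ?thesis
        unfolding t_def
        by (simp add: P_Q_D_E_def B'_def pochhammer_Suc mult_ac add_ac del: binomial_Suc_Suc)
    qed
    have GS: "G (Suc i) = (1 + of_nat k) * B * (d + of_nat k) * (P * (b + of_nat i)) * (Q * (c + of_nat i)) * D * E"
    proof -
      have "G (Suc i) = ((1 + of_nat i) * B') * (d + of_nat k) * (P * (b + of_nat i)) * (Q * (c + of_nat i)) * D * E"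
        by (simp add: G_def tS m algebra_simps)
      then show ?thesis by (simp only: B)
    qed
    define K i' k' where "K = P * Q * D * E * B * (d + of_nat k)"
      and "i' = (of_nat i :: 'a)" and "k' = (of_nat k :: 'a)"
    have eq: "B * (X i + X (Suc i))
        = K * ((d + 1 + k') * (e + i') * (e + i' + 1 + k') + (b + i') * (c + i') * (e + i' + 1 + k'))"
      unfolding Xi XS K_def i'_def k'_def by (simp add: distrib_left mult_ac)
    have eq1: "(e - b + of_nat m) * (e - c + of_nat m) * t i
        = K * ((e - b + (i' + (k' + 1))) * (e - c + (i' + (k' + 1))) * (e + i'))"
      unfolding ti K_def i'_def k'_def by (simp add: m mult_ac add_ac)
    have eq2: "G i = K * (i' * (d + k' + 1) * (e + i'))"
      unfolding G_def ti K_def i'_def k'_def by (simp add: m mult_ac add_ac)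
    have eq3: "G (Suc i) = K * ((1 + k') * (b + i') * (c + i'))"
      unfolding GS K_def i'_def k'_def by (simp add: mult_ac)
    \<comment> \<open>After the common factor \<open>K\<close> is removed, the certificate amounts
      to this polynomial identity.\<close>
    have eq4: "(d + 1 + k') * (e + i') * (e + i' + 1 + k') + (b + i') * (c + i') * (e + i' + 1 + k')
        = (e - b + (i' + (k' + 1))) * (e - c + (i' + (k' + 1))) * (e + i')
          + ((1 + k') * (b + i') * (c + i') - i' * (d + k' + 1) * (e + i'))"
      unfolding d_def by (simp add: algebra_simps)
    show ?thesis
      unfolding B_def[symmetric] eq eq1 eq2 eq3 eq4
      by (simp only: distrib_left[of K] right_diff_distrib[of K])
  qed
  \<comment> \<open>Pascal's rule splits the sum for \<open>Suc m\<close> into two sums over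
    \<open>m\<close>; shifting the index back in one of them yields the pairs
    \<open>X i + X (Suc i)\<close> that \<open>step\<close> treats.\<close>
  have S1: "(\<Sum>i\<le>Suc m. of_nat (Suc m choose i) * X i)
      = X 0 + (\<Sum>i\<le>m. of_nat (m choose i) * X (Suc i)) + (\<Sum>i\<le>m. of_nat (m choose Suc i) * X (Suc i))"
    by (subst sum.atMost_Suc_shift) (simp add: sum.distrib distrib_right)
  have "X 0 + (\<Sum>i\<le>m. of_nat (m choose Suc i) * X (Suc i)) = (\<Sum>i\<le>Suc m. of_nat (m choose i) * X i)"
    by (subst sum.atMost_Suc_shift) simp
  also have "\<dots> = (\<Sum>i\<le>m. of_nat (m choose i) * X i)"
    by (simp add: binomial_eq_0)
  finally have S2: "X 0 + (\<Sum>i\<le>m. of_nat (m choose Suc i) * X (Suc i)) = \<dots>" .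
  have "(\<Sum>i\<le>Suc m. of_nat (Suc m choose i) * X i)
      = (X 0 + (\<Sum>i\<le>m. of_nat (m choose Suc i) * X (Suc i))) + (\<Sum>i\<le>m. of_nat (m choose i) * X (Suc i))"
    unfolding S1 by (simp only: add_ac)
  also have "\<dots> = (\<Sum>i\<le>m. of_nat (m choose i) * (X i + X (Suc i)))"
    unfolding S2 by (simp only: sum.distrib distrib_left)
  also have "\<dots> = (\<Sum>i\<le>m. (e - b + of_nat m) * (e - c + of_nat m) * t i + (G (Suc i) - G i))"
    by (intro sum.cong refl step) auto
  also have "\<dots> = (e - b + of_nat m) * (e - c + of_nat m) * (\<Sum>i\<le>m. t i) + (G (Suc m) - G 0)"
    unfolding sum.distrib sum_distrib_left[symmetric] sum_telescope''
    by (simp add: sum_lessThan_telescope flip: lessThan_Suc_atMost)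
  also have "G (Suc m) - G 0 = 0"
    by (simp add: G_def t_def binomial_eq_0)
  finally show ?case
    using Suc.IH by (simp add: X_def t_def d_def pochhammer_Suc mult_ac)
qed

lemma sum_triangle_shift:
  fixes n :: nat
  shows "(\<Sum>j\<le>n. \<Sum>r\<le>j. f j r) = (\<Sum>r\<le>n. \<Sum>i\<le>n - r. f (r + i) r)"
proof -
  have "(\<Sum>(j, r)\<in>(SIGMA j:{..n}. {..j}). f j r) = (\<Sum>(r, i)\<in>(SIGMA r:{..n}. {..n - r}). f (r + i) r)"
    by (rule sum.reindex_bij_witness[of _ "\<lambda>(r, i). (r + i, r)" "\<lambda>(j, r). (r, j - r)"]) auto
  then show ?thesis by (simp add: sum.Sigma)
qed

text \<open>The pair \<open>(\<alpha>, bailey_beta a \<alpha>)\<close> is a Bailey pair relative to \<open>a\<close>, except that \<open>1 / (1 + a)\<^sub>m\<close> is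
  replaced by \<open>rGamma (1 + a + m)\<close>, which is also meaningful if \<open>1 + a\<close> is a pole of the Gamma
  function.\<close>

definition bailey_beta :: "complex \<Rightarrow> (nat \<Rightarrow> complex) \<Rightarrow> nat \<Rightarrow> complex" where
  "bailey_beta a \<alpha> n = (\<Sum>r\<le>n. \<alpha> r * rGamma (1 + a + of_nat n + of_nat r) / fact (n - r))"

text \<open>Off the poles this is the classical Bailey multiplier times the constant
  \<open>rGamma (1 + a - b) * rGamma (1 + a - c)\<close>. Reciprocal Gamma functions make it entire
  in all parameters, which the later continuation in \<open>c\<close> relies on.\<close>

definition bailey_weight :: "complex \<Rightarrow> complex \<Rightarrow> complex \<Rightarrow> nat \<Rightarrow> complex" where
  "bailey_weight a b c r = pochhammer b r * pochhammer c r
     * rGamma (1 + a - b + of_nat r) * rGamma (1 + a - c + of_nat r)"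

text \<open>Pfaff-Saalschuetz with parameters \<open>b + r\<close>, \<open>c + r\<close>,
  \<open>1 + a + 2 * r\<close> and length \<open>n - r\<close>. The two Pochhammer symbols that it
  produces lower the arguments of the outer \<open>rGamma\<close> factors from \<open>n\<close> to
  \<open>r\<close>.\<close>

lemma bailey_inner_sum:
  assumes "r \<le> n"
  shows "(\<Sum>i\<le>n - r. pochhammer b (r + i) * pochhammer c (r + i)
            * pochhammer (1 + a - b - c) (n - (r + i)) / fact (n - (r + i))
            * (rGamma (1 + a + of_nat (r + i) + of_nat r) / fact i))
           * rGamma (1 + a - b + of_nat n) * rGamma (1 + a - c + of_nat n)
         = bailey_weight a b c r * rGamma (1 + a + of_nat n + of_nat r) / fact (n - r)"
proof -
  define m where "m = n - r"
  have n: "n = r + m" using assms by (simp add: m_def)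
  define B C e where "B = b + of_nat r" "C = c + of_nat r" "e = 1 + a + 2 * of_nat r"
  define R where "R = rGamma (e + of_nat m)"
  have "(\<Sum>i\<le>m. pochhammer b (r + i) * pochhammer c (r + i)
            * pochhammer (1 + a - b - c) (n - (r + i)) / fact (n - (r + i))
            * (rGamma (1 + a + of_nat (r + i) + of_nat r) / fact i))
      = (\<Sum>i\<le>m. pochhammer b r * pochhammer c r * R / fact m
            * (of_nat (m choose i) * pochhammer B i * pochhammer C i
            * pochhammer (e - B - C) (m - i) * pochhammer (e + of_nat i) (m - i)))"
  proof (intro sum.cong refl)
    fix i assume "i \<in> {..m}"
    then have i: "i \<le> m" by simp
    have 1: "rGamma (e + of_nat i) = pochhammer (e + of_nat i) (m - i) * R"
      using pochhammer_rGamma[of "e + of_nat i" "m - i"] i by (simp add: R_def of_nat_diff)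
    have 2: "1 + a + of_nat (r + i) + of_nat r = e + of_nat i"
      "1 + a - b - c = e - B - C" "n - (r + i) = m - i"
      "b + of_nat r = B" "c + of_nat r = C"
      by (simp_all add: B_C_e_def n)
    show "pochhammer b (r + i) * pochhammer c (r + i)
            * pochhammer (1 + a - b - c) (n - (r + i)) / fact (n - (r + i))
            * (rGamma (1 + a + of_nat (r + i) + of_nat r) / fact i)
        = pochhammer b r * pochhammer c r * R / fact m
            * (of_nat (m choose i) * pochhammer B i * pochhammer C i
            * pochhammer (e - B - C) (m - i) * pochhammer (e + of_nat i) (m - i))"
      unfolding 2 1 pochhammer_product' using i by (simp add: binomial_fact mult_ac)
  qed
  also have "\<dots> = pochhammer b r * pochhammer c r * R / fact m * (pochhammer (e - B) m * pochhammer (e - C) m)"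
    unfolding sum_distrib_left[symmetric] by (simp only: pfaff_saalschuetz)
  finally have *: "(\<Sum>i\<le>m. pochhammer b (r + i) * pochhammer c (r + i)
            * pochhammer (1 + a - b - c) (n - (r + i)) / fact (n - (r + i))
            * (rGamma (1 + a + of_nat (r + i) + of_nat r) / fact i)) = \<dots>" .
  have "rGamma (1 + a - b + of_nat r) = pochhammer (e - B) m * rGamma (1 + a - b + of_nat n)"
    "rGamma (1 + a - c + of_nat r) = pochhammer (e - C) m * rGamma (1 + a - c + of_nat n)"
    using pochhammer_rGamma[of "e - B" m] pochhammer_rGamma[of "e - C" m]
    by (simp_all add: B_C_e_def n algebra_simps)
  moreover have "1 + a + of_nat n + of_nat r = e + of_nat m"
    by (simp add: B_C_e_def n)
  ultimately show ?thesis
    unfolding m_def[symmetric] * bailey_weight_def R_def by simp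
qed

text \<open>Interchanging the two finite sums leaves, for each \<open>r\<close>, exactly the sum in
  \<open>bailey_inner_sum\<close>.\<close>

lemma bailey_lemma_finite:
  "(\<Sum>j\<le>n. pochhammer b j * pochhammer c j * pochhammer (1 + a - b - c) (n - j) / fact (n - j)
        * bailey_beta a \<alpha> j) * rGamma (1 + a - b + of_nat n) * rGamma (1 + a - c + of_nat n)
   = bailey_beta a (\<lambda>r. \<alpha> r * bailey_weight a b c r) n"
proof -
  have "(\<Sum>j\<le>n. pochhammer b j * pochhammer c j * pochhammer (1 + a - b - c) (n - j) / fact (n - j)
        * bailey_beta a \<alpha> j)
     = (\<Sum>j\<le>n. \<Sum>r\<le>j. \<alpha> r * (pochhammer b j * pochhammer c j * pochhammer (1 + a - b - c) (n - j) / fact (n - j)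
        * (rGamma (1 + a + of_nat j + of_nat r) / fact (j - r))))"
    by (simp add: bailey_beta_def sum_distrib_left sum_divide_distrib mult_ac)
  also have "\<dots> = (\<Sum>r\<le>n. \<alpha> r * (\<Sum>i\<le>n - r. pochhammer b (r + i) * pochhammer c (r + i)
            * pochhammer (1 + a - b - c) (n - (r + i)) / fact (n - (r + i))
            * (rGamma (1 + a + of_nat (r + i) + of_nat r) / fact i)))"
    by (simp add: sum_triangle_shift sum_distrib_left)
  finally have "(\<Sum>j\<le>n. pochhammer b j * pochhammer c j * pochhammer (1 + a - b - c) (n - j) / fact (n - j)
        * bailey_beta a \<alpha> j) * rGamma (1 + a - b + of_nat n) * rGamma (1 + a - c + of_nat n)
     = (\<Sum>r\<le>n. \<alpha> r * ((\<Sum>i\<le>n - r. pochhammer b (r + i) * pochhammer c (r + i)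
            * pochhammer (1 + a - b - c) (n - (r + i)) / fact (n - (r + i))
            * (rGamma (1 + a + of_nat (r + i) + of_nat r) / fact i))
            * rGamma (1 + a - b + of_nat n) * rGamma (1 + a - c + of_nat n)))"
    by (simp only: sum_distrib_right mult.assoc)
  also have "\<dots> = bailey_beta a (\<lambda>r. \<alpha> r * bailey_weight a b c r) n"
    unfolding bailey_beta_def
    by (intro sum.cong refl) (subst bailey_inner_sum, auto)
  finally show ?thesis .
qed

section \<open>The unit Bailey pair\<close>

definition unit_alpha :: "complex \<Rightarrow> nat \<Rightarrow> complex" where
  "unit_alpha a n = pochhammer a n * pochhammer (1 + a/2) n / pochhammer (a/2) n * ((-1) ^ n / fact n)"

lemma unit_alpha_0 [simp]: "unit_alpha a 0 = 1"
  by (simp add: unit_alpha_def)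

text \<open>The very-well-poised quotient \<open>pochhammer (1 + a/2) n / pochhammer (a/2) n\<close>
  collapses to \<open>(a + 2 * n) / a\<close>, and the denominator cancels the first factor of
  \<open>pochhammer a n\<close>.\<close>

lemma unit_alpha_Suc:
  assumes "a / 2 \<notin> \<int>\<^sub>\<le>\<^sub>0"
  shows "unit_alpha a (Suc n)
           = (-1) ^ Suc n * (a + 2 * of_nat (Suc n)) * pochhammer (a + 1) n / fact (Suc n)"
proof -
  have nz: "pochhammer (a/2) k \<noteq> 0" for k
    using assms pochhammer_eq_0_imp_nonpos_Int by blast
  have a0: "a \<noteq> 0" using assms by auto
  have "a / 2 * pochhammer (1 + a/2) (Suc n) = pochhammer (a/2) (Suc n) * (a/2 + of_nat (Suc n))"
    using pochhammer_rec[of "a/2" "Suc n"] pochhammer_Suc[of "a/2" "Suc n"] by (simp add: add_ac)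
  then have "pochhammer (1 + a/2) (Suc n) / pochhammer (a/2) (Suc n) = (a + 2 * of_nat (Suc n)) / a"
    using a0 nz[of "Suc n"] by (simp add: field_simps del: of_nat_Suc)
  moreover have "pochhammer a (Suc n) = a * pochhammer (a + 1) n" by (rule pochhammer_rec)
  ultimately show ?thesis
    using a0 unfolding unit_alpha_def times_divide_eq_right[of _ "pochhammer (1 + a/2) (Suc n)", symmetric]
    by (simp del: of_nat_Suc power_Suc fact_Suc)
qed

text \<open>The sum defining \<beta> is indefinitely summable: its partial sums have a closed form,
  which induction on \<open>m\<close> confirms. The bound \<open>m < n\<close> keeps
  \<open>n\<close> nonzero and \<open>n - Suc m\<close> free of truncation.\<close>

lemma bailey_beta_unit_partial:
  assumes "a / 2 \<notin> \<int>\<^sub>\<le>\<^sub>0" and "m < n"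
  shows "(\<Sum>r\<le>m. unit_alpha a r * rGamma (1 + a + of_nat n + of_nat r) / fact (n - r))
     = (-1) ^ m * pochhammer (a + 1) m * rGamma (1 + a + of_nat n + of_nat m)
         / (of_nat n * fact m * fact (n - Suc m))"
  using \<open>m < n\<close>
proof (induction m)
  case 0
  then show ?case by (cases n) (auto simp: field_simps)
next
  case (Suc m)
  then obtain k where n: "n = Suc (Suc (m + k))"
    by (metis less_imp_Suc_add add_Suc)
  define R where "R = rGamma (1 + a + of_nat n + of_nat (Suc m))"
  have R: "rGamma (1 + a + of_nat n + of_nat m) = (1 + a + of_nat n + of_nat m) * R"
    using rGamma_plus1[of "1 + a + of_nat n + of_nat m"] by (simp add: R_def add_ac)
  have N: "of_nat n \<noteq> (0::complex)" "of_nat n = 2 + of_nat m + (of_nat k :: complex)"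
    using Suc.prems by (simp, simp add: n)
  define F where "F = (fact k :: complex)"
  define M where "M = (fact m :: complex)"
  have F: "fact (n - Suc m) = (of_nat k + 1) * F" "fact (n - Suc (Suc m)) = F"
     "fact (Suc m) = (of_nat m + 1) * M" "fact m = M"
    by (simp_all add: n F_def M_def algebra_simps)
  have nz: "F \<noteq> 0" "M \<noteq> 0" "of_nat k + 1 \<noteq> (0::complex)" "of_nat m + 1 \<noteq> (0::complex)"
    unfolding F_def M_def using of_nat_neq_0[of k, where ?'a = complex] of_nat_neq_0[of m, where ?'a = complex] by (auto simp: add_ac)
  define m1 k1 where "m1 = (1 + of_nat m :: complex)" and "k1 = (1 + of_nat k :: complex)"
  define K where "K = (-1) ^ m * pochhammer (a + 1) m * R / (M * F)"
  have nz': "m1 \<noteq> 0" "k1 \<noteq> 0" "m1 + k1 \<noteq> 0" and Nmk: "of_nat n = m1 + k1"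
    using nz N by (auto simp: m1_def k1_def add_ac)
  have R': "rGamma (1 + a + of_nat n + of_nat m) = (a + m1 + m1 + k1) * R"
    unfolding R by (simp add: N(2) m1_def k1_def add_ac)
  \<comment> \<open>This is the induction step after division by the common factor \<open>K\<close>,
    with \<open>n\<close> written as \<open>m1 + k1\<close>.\<close>
  have key: "(a + m1 + m1 + k1) / ((m1 + k1) * k1) - (a + 2 * m1) / (m1 * k1)
      = - ((a + m1) / ((m1 + k1) * m1))"
    using nz' by (simp add: divide_simps) (simp add: algebra_simps)
  have "(-1) ^ m * pochhammer (a + 1) m * rGamma (1 + a + of_nat n + of_nat m)
         / (of_nat n * fact m * fact (n - Suc m)) = K * ((a + m1 + m1 + k1) / ((m1 + k1) * k1))"
    unfolding R' F K_def by (simp add: Nmk m1_def k1_def add_ac mult_ac)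
  moreover have "unit_alpha a (Suc m) * R / fact (n - Suc m) = - (K * ((a + 2 * m1) / (m1 * k1)))"
    unfolding unit_alpha_Suc[OF assms(1)] F K_def by (simp add: m1_def k1_def add_ac mult_ac)
  moreover have "(-1) ^ Suc m * pochhammer (a + 1) (Suc m) * R / (of_nat n * fact (Suc m) * fact (n - Suc (Suc m)))
      = K * (- ((a + m1) / ((m1 + k1) * m1)))"
    unfolding F K_def Nmk pochhammer_Suc by (simp add: m1_def k1_def add_ac mult_ac)
  moreover have "(\<Sum>r\<le>m. unit_alpha a r * rGamma (1 + a + of_nat n + of_nat r) / fact (n - r))
     = (-1) ^ m * pochhammer (a + 1) m * rGamma (1 + a + of_nat n + of_nat m)
         / (of_nat n * fact m * fact (n - Suc m))"
    using Suc.prems by (intro Suc.IH) simp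
  ultimately show ?case
    unfolding sum.atMost_Suc R_def[symmetric] key[symmetric]
    by (simp only: distrib_left mult_minus_right diff_conv_add_uminus)
qed

text \<open>For \<open>n > 0\<close> the closed form of the partial sum up to \<open>n - 1\<close>
  is the negative of the last term \<open>r = n\<close>.\<close>

lemma bailey_beta_unit:
  assumes "a / 2 \<notin> \<int>\<^sub>\<le>\<^sub>0"
  shows "bailey_beta a (unit_alpha a) n = (if n = 0 then rGamma (1 + a) else 0)"
proof (cases n)
  case 0
  then show ?thesis by (simp add: bailey_beta_def)
next
  case (Suc m)
  have R: "rGamma (1 + a + of_nat n + of_nat m) = (a + 2 * of_nat n) * rGamma (1 + a + of_nat n + of_nat n)"
    using rGamma_plus1[of "1 + a + of_nat n + of_nat m"] by (simp add: Suc algebra_simps)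
  have "bailey_beta a (unit_alpha a) n
      = (\<Sum>r\<le>m. unit_alpha a r * rGamma (1 + a + of_nat n + of_nat r) / fact (n - r))
        + unit_alpha a n * rGamma (1 + a + of_nat n + of_nat n)"
    by (simp add: bailey_beta_def Suc)
  also have "\<dots> = 0"
    using bailey_beta_unit_partial[OF assms, of m n] of_nat_neq_0[of m, where ?'a = complex]
    unfolding R by (simp add: Suc unit_alpha_Suc[OF assms] del: of_nat_Suc)
  finally show ?thesis using Suc by simp
qed

section \<open>Convergence factors of bounded variation\<close>

text \<open>Abel summation by parts, with the tails of \<open>A\<close> in place of its partial
  sums. The tails are bounded, so the transformed series converges absolutely even if
  \<open>A\<close> converges only conditionally.\<close>

lemma sums_mult_bounded_variation:
  fixes A G :: "nat \<Rightarrow> complex"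
  assumes A: "A sums S" and G: "summable (\<lambda>r. norm (G (Suc r) - G r))"
  shows "summable (\<lambda>r. norm ((S - (\<Sum>k\<le>r. A k)) * (G (Suc r) - G r)))"
    and "(\<lambda>r. A r * G r) sums (S * G 0 + (\<Sum>r. (S - (\<Sum>k\<le>r. A k)) * (G (Suc r) - G r)))"
proof -
  \<comment> \<open>\<open>R n\<close> is the tail that starts at index \<open>n\<close>; the tails
    in the statement are therefore \<open>R (Suc r)\<close>.\<close>
  define R where "R = (\<lambda>n. S - (\<Sum>k<n. A k))"
  have R0: "R \<longlonglongrightarrow> 0"
    using tendsto_diff[OF tendsto_const[of S] A[unfolded sums_def]] by (simp add: R_def)
  then obtain K where K: "norm (R n) \<le> K" for n
    using convergent_imp_Bseq[of R] unfolding convergent_def Bseq_def by blast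
  show *: "summable (\<lambda>r. norm ((S - (\<Sum>k\<le>r. A k)) * (G (Suc r) - G r)))"
  proof (rule summable_comparison_test')
    show "summable (\<lambda>r. K * norm (G (Suc r) - G r))" using G by (rule summable_mult)
    show "norm (norm ((S - (\<Sum>k\<le>r. A k)) * (G (Suc r) - G r))) \<le> K * norm (G (Suc r) - G r)" for r
      using K[of "Suc r"] by (simp add: R_def norm_mult mult_right_mono lessThan_Suc_atMost)
  qed
  have "(\<lambda>n. G 0 + (\<Sum>r<n. G (Suc r) - G r)) \<longlonglongrightarrow> G 0 + (\<Sum>r. G (Suc r) - G r)"
    by (intro tendsto_intros summable_LIMSEQ summable_norm_cancel[OF G])
  then have "G \<longlonglongrightarrow> G 0 + (\<Sum>r. G (Suc r) - G r)"
    by (simp add: sum_lessThan_telescope)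
  then have RG: "(\<lambda>n. R n * G n) \<longlonglongrightarrow> 0"
    using tendsto_mult[OF R0] by fastforce
  have parts: "(\<Sum>r<n. A r * G r) = S * G 0 - R n * G n
      + (\<Sum>r<n. (S - (\<Sum>k\<le>r. A k)) * (G (Suc r) - G r))" for n
    by (induction n) (auto simp: R_def algebra_simps simp flip: lessThan_Suc_atMost)
  have "(\<lambda>n. S * G 0 - R n * G n + (\<Sum>r<n. (S - (\<Sum>k\<le>r. A k)) * (G (Suc r) - G r)))
      \<longlonglongrightarrow> S * G 0 - 0 + (\<Sum>r. (S - (\<Sum>k\<le>r. A k)) * (G (Suc r) - G r))"
    by (intro tendsto_intros RG summable_LIMSEQ summable_norm_cancel[OF *])
  then show "(\<lambda>r. A r * G r) sums (S * G 0 + (\<Sum>r. (S - (\<Sum>k\<le>r. A k)) * (G (Suc r) - G r)))"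
    unfolding sums_def parts by simp
qed

text \<open>A regularity theorem for convergence factors. After summation by parts the terms from
  \<open>N\<close> on contribute at most a small tail times the total variation \<open>V\<close>,
  uniformly in \<open>x\<close>, and the finitely many earlier ones tend to 0 because every
  \<open>G x r\<close> tends to 1.\<close>

lemma tendsto_suminf_bounded_variation:
  fixes A :: "nat \<Rightarrow> complex" and G :: "'x \<Rightarrow> nat \<Rightarrow> complex"
  assumes A: "A sums S"
    and lim: "\<And>r. ((\<lambda>x. G x r) \<longlongrightarrow> 1) F"
    and var: "\<forall>\<^sub>F x in F. \<forall>N. (\<Sum>r<N. norm (G x (Suc r) - G x r)) \<le> V"
  shows "((\<lambda>x. \<Sum>r. A r * G x r) \<longlongrightarrow> S) F"
proof (rule tendstoI)
  fix e :: real assume e: "e > 0"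
  \<comment> \<open>A strictly positive bound, so that division by it is possible whatever the sign
    of \<open>V\<close>.\<close>
  define V' where "V' = max V 0 + 1"
  have V': "V' > 0" "V < V'" by (auto simp: V'_def)
  define T where "T = (\<lambda>r. S - (\<Sum>k\<le>r. A k))"
  have "T \<longlonglongrightarrow> S - S"
    unfolding T_def using A by (intro tendsto_intros) (simp add: sums_def_le)
  then have "\<forall>\<^sub>F r in sequentially. norm (T r) < e / 2 / V'"
    using e V' by (auto simp: tendsto_iff dist_norm)
  then obtain N where N: "\<And>r. r \<ge> N \<Longrightarrow> norm (T r) < e / 2 / V'"
    by (auto simp: eventually_sequentially)
  define D where "D = (\<lambda>x. S * (G x 0 - 1) + (\<Sum>r<N. T r * (G x (Suc r) - G x r)))"
  have "(D \<longlongrightarrow> S * (1 - 1) + (\<Sum>r<N. T r * (1 - 1))) F"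
    unfolding D_def by (intro tendsto_intros lim)
  then have "\<forall>\<^sub>F x in F. norm (D x) < e / 2"
    using tendstoD[of D 0 F "e / 2"] e by (simp add: dist_norm)
  with var show "\<forall>\<^sub>F x in F. dist (\<Sum>r. A r * G x r) S < e"
  proof eventually_elim
    case (elim x)
    have sm: "summable (\<lambda>r. norm (G x (Suc r) - G x r))"
      using elim(1) by (intro summableI_nonneg_bounded[of _ V]) auto
    have sV: "(\<Sum>r. norm (G x (Suc r) - G x r)) \<le> V"
      using elim(1) by (intro suminf_le_const[OF sm]) auto
    have Tr: "S - (\<Sum>k\<le>r. A k) = T r" for r by (simp add: T_def)
    note bv = sums_mult_bounded_variation[OF A sm, unfolded Tr]
    have sm': "summable (\<lambda>r. norm (G x (Suc (r + N)) - G x (r + N)))"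
      using summable_ignore_initial_segment[OF sm, of N] by simp
    define Q where "Q = (\<Sum>r. T (r + N) * (G x (Suc (r + N)) - G x (r + N)))"
    have "(\<Sum>r. A r * G x r) - S = D x + Q"
      using sums_unique[OF bv(2)] suminf_split_initial_segment[OF summable_norm_cancel[OF bv(1)], of N]
      by (simp add: D_def Q_def right_diff_distrib add_ac)
    moreover have "norm Q \<le> e / 2"
    proof -
      have "norm Q \<le> (\<Sum>r. e / 2 / V' * norm (G x (Suc (r + N)) - G x (r + N)))"
        unfolding Q_def
      proof (rule norm_suminf_le)
        show "norm (T (r + N) * (G x (Suc (r + N)) - G x (r + N)))
            \<le> e / 2 / V' * norm (G x (Suc (r + N)) - G x (r + N))" for r
          using N[of "r + N"] unfolding norm_mult by (intro mult_right_mono) auto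
      qed (intro summable_mult sm')
      also have "\<dots> = e / 2 / V' * (\<Sum>r. norm (G x (Suc (r + N)) - G x (r + N)))"
        by (rule suminf_mult[OF sm'])
      also have "(\<Sum>r. norm (G x (Suc (r + N)) - G x (r + N))) \<le> V"
        using suminf_split_initial_segment[OF sm, of N] sV
          sum_nonneg[of "{..<N}" "\<lambda>r. norm (G x (Suc r) - G x r)"] by simp
      then have "e / 2 / V' * (\<Sum>r. norm (G x (Suc (r + N)) - G x (r + N))) \<le> e / 2 / V' * V'"
        using e V' by (intro mult_left_mono) auto
      also have "\<dots> = e / 2" using V' by simp
      finally show ?thesis .
    qed
    ultimately have "norm ((\<Sum>r. A r * G x r) - S) \<le> norm (D x) + e / 2"
      using norm_triangle_ineq[of "D x" Q] by simp
    with elim(2) show ?case by (simp add: dist_norm)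
  qed
qed

section \<open>Damping factors that arise from the shift of \<open>c\<close> to
  \<open>c - t\<close>\<close>

lemma holomorphic_on_suminf:
  fixes f :: "nat \<Rightarrow> complex \<Rightarrow> complex"
  assumes "open U" and hol: "\<And>n. f n holomorphic_on U"
    and M: "\<And>x. x \<in> U \<Longrightarrow> \<exists>d>0. \<exists>M. cball x d \<subseteq> U \<and> summable M \<and> (\<forall>n. \<forall>t\<in>cball x d. norm (f n t) \<le> M n)"
  shows "(\<lambda>t. \<Sum>n. f n t) holomorphic_on U"
proof (rule holomorphic_uniform_sequence[OF \<open>open U\<close>])
  show "(\<lambda>t. \<Sum>k<n. f k t) holomorphic_on U" for n
    by (intro holomorphic_intros hol)
  fix x assume "x \<in> U"
  then obtain d M where "d > 0" "cball x d \<subseteq> U" "summable M" "\<forall>n. \<forall>t\<in>cball x d. norm (f n t) \<le> M n"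
    using M[OF \<open>x \<in> U\<close>] by (elim exE conjE) (rule that)
  then show "\<exists>d>0. cball x d \<subseteq> U \<and> uniform_limit (cball x d) (\<lambda>n t. \<Sum>k<n. f k t) (\<lambda>t. \<Sum>n. f n t) sequentially"
    by (intro exI[of _ d] conjI Weierstrass_m_test) auto
qed

text \<open>The term \<open>t / (w + i)\<close> differs from \<open>t / (i + 1)\<close> by a
  quantity of order \<open>1 / (i + 1)^2\<close>, uniformly for bounded \<open>t\<close> and
  \<open>w\<close>. In exponential form the product over \<open>i\<close> will split into a harmonic
  sum and a convergent one.\<close>

lemma norm_one_minus_le:
  fixes t w :: complex
  assumes "Re w \<ge> 1" and "norm t \<le> \<rho>" and "norm (w - 1) \<le> \<kappa>"
  shows "norm (1 - t / (w + of_nat i))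
           \<le> exp ((\<rho> * \<kappa> + \<rho>\<^sup>2 / 2) * (1 / (real i + 1)\<^sup>2) - Re t / (real i + 1))"
proof -
  define n where "n = real i + 1"
  have n: "n \<ge> 1" by (simp add: n_def)
  have \<rho>: "\<rho> \<ge> 0" using assms(2) norm_ge_zero[of t] by linarith
  define v where "v = w + of_nat i"
  have v: "n \<le> norm v"
    using complex_Re_le_cmod[of v] assms(1) by (simp add: v_def n_def)
  then have v0: "norm v > 0" "v \<noteq> 0" using n by auto
  define z where "z = - t / v"
  have zn: "norm z \<le> \<rho> / n"
    using v n assms(2) \<rho> unfolding z_def norm_divide norm_minus_cancel by (intro frac_le) auto
  have "(norm (1 + z))\<^sup>2 = 1 + (2 * Re z + (norm z)\<^sup>2)"
    unfolding cmod_power2 by (simp add: power2_eq_square algebra_simps)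
  also have "\<dots> \<le> exp (2 * Re z + (norm z)\<^sup>2)" by (rule exp_ge_add_one_self)
  also have "\<dots> = (exp (Re z + (norm z)\<^sup>2 / 2))\<^sup>2"
    by (simp add: power2_eq_square flip: exp_add)
  finally have "norm (1 + z) \<le> exp (Re z + (norm z)\<^sup>2 / 2)"
    by (rule power2_le_imp_le) simp
  also have "Re z + (norm z)\<^sup>2 / 2 \<le> (\<rho> * \<kappa> + \<rho>\<^sup>2 / 2) * (1 / n\<^sup>2) - Re t / n"
  proof -
    \<comment> \<open>Since \<open>v - n = w - 1\<close>, this isolates the leading part
      \<open>- t / n\<close> of \<open>z\<close>.\<close>
    have "z + t / of_real n = t * (w - 1) / (v * of_real n)"
      using v0 n by (simp add: z_def field_simps) (simp add: v_def n_def algebra_simps)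
    then have "norm (z + t / of_real n) \<le> \<rho> * \<kappa> / (n * n)"
      using v n \<rho> assms(2,3) norm_ge_zero[of "w - 1"]
      unfolding norm_divide norm_mult
      by (simp add: norm_divide norm_mult) (intro frac_le mult_mono, auto intro: mult_nonneg_nonneg order_trans[OF norm_ge_zero])
    moreover have "Re (z + t / of_real n) = Re z + Re t / n" by simp
    ultimately have "Re z \<le> \<rho> * \<kappa> / (n * n) - Re t / n"
      using complex_Re_le_cmod[of "z + t / of_real n"] by linarith
    moreover have "(norm z)\<^sup>2 \<le> (\<rho> / n)\<^sup>2" using zn by (intro power_mono) auto
    ultimately show ?thesis
      by (simp add: power2_eq_square add_divide_distrib distrib_right)
  qed
  finally show ?thesis by (simp add: z_def v_def n_def)
qed

text \<open>The bounds of \<open>norm_one_minus_le\<close> are multiplied. The quadratic parts add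
  up to at most \<open>pi^2 / 6\<close>, which gives a constant independent of \<open>r\<close>, and
  the linear parts give decay like \<open>r\<close> to the power \<open>- Re t\<close>.\<close>

lemma norm_pochhammer_ratio_le:
  fixes t w :: complex
  assumes w: "Re w \<ge> 1" and t: "norm t \<le> \<rho>" and \<kappa>: "norm (w - 1) \<le> \<kappa>"
  shows "norm (pochhammer (w - t) r / pochhammer w r)
           \<le> exp ((\<rho> * \<kappa> + \<rho>\<^sup>2 / 2) * (pi\<^sup>2 / 6)) * exp (- (Re t * harm r))"
proof -
  define K where "K = \<rho> * \<kappa> + \<rho>\<^sup>2 / 2"
  have "\<rho> \<ge> 0" "\<kappa> \<ge> 0" using t \<kappa> norm_ge_zero order_trans by blast+
  then have K: "K \<ge> 0" by (simp add: K_def)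
  have nz: "w + of_nat i \<noteq> 0" for i
    using w by (auto simp: complex_eq_iff)
  have "norm (pochhammer (w - t) r / pochhammer w r)
      \<le> exp (K * (\<Sum>i<r. 1 / (real i + 1)\<^sup>2) - Re t * harm r)"
  proof (induction r)
    case 0
    show ?case by (simp add: harm_def)
  next
    case (Suc r)
    have "pochhammer (w - t) (Suc r) / pochhammer w (Suc r)
        = (pochhammer (w - t) r / pochhammer w r) * (1 - t / (w + of_nat r))"
      using nz[of r] by (simp add: pochhammer_Suc field_simps)
    also have "norm \<dots> \<le> exp (K * (\<Sum>i<r. 1 / (real i + 1)\<^sup>2) - Re t * harm r)
        * exp (K * (1 / (real r + 1)\<^sup>2) - Re t / (real r + 1))"
      unfolding norm_mult K_def
      using Suc.IH norm_one_minus_le[OF assms, of r] by (intro mult_mono) (auto simp: K_def)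
    also have "\<dots> = exp (K * (\<Sum>i<Suc r. 1 / (real i + 1)\<^sup>2) - Re t * harm (Suc r))"
      by (simp add: harm_Suc distrib_left inverse_eq_divide add_ac flip: exp_add)
    finally show ?case .
  qed
  also have "\<dots> \<le> exp (K * (pi\<^sup>2 / 6) + - (Re t * harm r))"
  proof -
    have "(\<Sum>i<r. 1 / (real i + 1)\<^sup>2) \<le> (\<Sum>i. 1 / (real i + 1)\<^sup>2)"
      using inverse_squares_sums by (intro sum_le_suminf) (auto simp: sums_iff add_ac)
    also have "\<dots> = pi\<^sup>2 / 6" using inverse_squares_sums by (auto simp: sums_iff add_ac)
    finally have "K * (\<Sum>i<r. 1 / (real i + 1)\<^sup>2) \<le> K * (pi\<^sup>2 / 6)"
      using K by (rule mult_left_mono)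
    then show ?thesis by simp
  qed
  finally show ?thesis by (simp only: K_def exp_add)
qed

text \<open>Factorwise this is \<open>1 + x \<le> exp x\<close>. The right-hand side is preferred
  because its weighted sum telescopes in \<open>sum_fact_over_pochhammer_le\<close>.\<close>

lemma exp_minus_harm_le:
  assumes "\<tau> \<ge> 0"
  shows "exp (- (\<tau> * harm r)) \<le> fact r / pochhammer (1 + \<tau> :: real) r"
proof (induction r)
  case (Suc r)
  have "exp (- (\<tau> / (real r + 1))) \<le> 1 / (1 + \<tau> / (real r + 1))"
    using exp_ge_add_one_self[of "\<tau> / (real r + 1)"] assms
    by (simp add: exp_minus inverse_eq_divide add_pos_nonneg frac_le)
  also have "\<dots> = (real r + 1) / (1 + \<tau> + real r)"
    using assms by (simp add: field_simps)
  finally have *: "exp (- (\<tau> / (real r + 1))) \<le> (real r + 1) / (1 + \<tau> + real r)" .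
  have "exp (- (\<tau> * harm (Suc r))) = exp (- (\<tau> * harm r)) * exp (- (\<tau> / (real r + 1)))"
    by (simp add: harm_Suc field_simps flip: exp_add)
  also have "\<dots> \<le> fact r / pochhammer (1 + \<tau>) r * ((real r + 1) / (1 + \<tau> + real r))"
    using Suc.IH * assms by (intro mult_mono divide_nonneg_nonneg pochhammer_nonneg) auto
  also have "\<dots> = fact (Suc r) / pochhammer (1 + \<tau>) (Suc r)"
    by (simp add: pochhammer_Suc mult_ac add_ac)
  finally show ?case .
qed (simp add: harm_def)

text \<open>The quotient \<open>P r\<close> satisfies
  \<open>P r - P (Suc r) = P r * \<tau> / (1 + \<tau> + r)\<close>, so the sum is dominated by a
  telescoping one. The factor \<tau> on the left keeps the bound finite as \<tau> tends to
  0.\<close>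

lemma sum_fact_over_pochhammer_le:
  assumes "\<tau> \<ge> 0"
  shows "\<tau> * (\<Sum>r<N. fact r / pochhammer (1 + \<tau> :: real) r / (real r + 1)) \<le> 1 + \<tau>"
proof -
  define P where "P = (\<lambda>r. fact r / pochhammer (1 + \<tau> :: real) r)"
  have pos: "pochhammer (1 + \<tau>) r > 0" for r
    using assms by (intro pochhammer_pos) auto
  have P: "P r \<ge> 0" for r using pos[of r] by (simp add: P_def)
  have step: "\<tau> * (P r / (real r + 1)) \<le> (1 + \<tau>) * (P r - P (Suc r))" for r
  proof -
    have PS: "P (Suc r) = P r * ((real r + 1) / (1 + \<tau> + real r))"
      by (simp add: P_def pochhammer_Suc mult_ac add_ac)
    have "1 - (real r + 1) / (1 + \<tau> + real r) = \<tau> / (1 + \<tau> + real r)"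
      using assms by (simp add: field_simps)
    then have "P r - P (Suc r) = P r * (\<tau> / (1 + \<tau> + real r))"
      unfolding PS by (metis mult.right_neutral right_diff_distrib)
    moreover have "\<tau> / (real r + 1) \<le> (1 + \<tau>) * (\<tau> / (1 + \<tau> + real r))"
    proof -
      have "\<tau> / (real r + 1) = \<tau> * (1 + \<tau>) / ((1 + \<tau>) * (real r + 1))"
        using assms by simp
      also have "\<dots> \<le> \<tau> * (1 + \<tau>) / (1 + \<tau> + real r)"
        using assms by (intro divide_left_mono mult_pos_pos) (auto simp: algebra_simps)
      finally show ?thesis by (simp add: mult_ac)
    qed
    then have "P r * (\<tau> / (real r + 1)) \<le> P r * ((1 + \<tau>) * (\<tau> / (1 + \<tau> + real r)))"
      using P by (intro mult_left_mono)
    ultimately show ?thesis by (simp add: mult_ac)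
  qed
  have "\<tau> * (\<Sum>r<N. P r / (real r + 1)) \<le> (\<Sum>r<N. (1 + \<tau>) * (P r - P (Suc r)))"
    unfolding sum_distrib_left by (intro sum_mono step)
  also have "\<dots> = (1 + \<tau>) * (P 0 - P N)"
    by (simp add: sum_lessThan_telescope' flip: sum_distrib_left)
  also have "\<dots> \<le> (1 + \<tau>) * 1"
    using P[of N] assms by (intro mult_left_mono) (auto simp: P_def)
  finally show ?thesis by (simp add: P_def)
qed

text \<open>With \<open>e = 1 + a - c\<close> this is, up to a factor free of \<open>r\<close>, the
  effect on the \<open>r\<close>-th term of the \<alpha> side of replacing \<open>c\<close> by
  \<open>c - t\<close>.\<close>

definition damping :: "complex \<Rightarrow> complex \<Rightarrow> complex \<Rightarrow> nat \<Rightarrow> complex" where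
  "damping c e t r = pochhammer (c - t) r / pochhammer c r * (pochhammer e r / pochhammer (e + t) r)"

lemma damping_0 [simp]: "damping c e t 0 = 1"
  by (simp add: damping_def)

text \<open>Consecutive values have the quotient
  \<open>1 - t * (c + e + 2 * r) / ((c + r) * (e + t + r))\<close>, so an increment is the value
  times a quantity of order \<open>norm t / (r + 1)\<close>. Each of the two Pochhammer quotients
  decays with exponent \<open>Re t\<close>, whence \<open>2 * \<delta>\<close>; the free \<delta>
  allows one majorant for a whole disc of \<open>t\<close>.\<close>

lemma damping_variation:
  assumes c: "Re c \<ge> 1" and e: "Re e \<ge> 1" and "\<rho> \<ge> 0"
  obtains C where "C \<ge> 0" and "\<And>t r \<delta>. norm t \<le> \<rho> \<Longrightarrow> 0 \<le> \<delta> \<Longrightarrow> \<delta> \<le> Re t \<Longrightarrow>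
    norm (damping c e t (Suc r) - damping c e t r)
      \<le> C * norm t * (fact r / pochhammer (1 + 2 * \<delta>) r / (real r + 1))"
proof -
  define K where "K = (\<lambda>\<kappa>. exp ((\<rho> * \<kappa> + \<rho>\<^sup>2 / 2) * (pi\<^sup>2 / 6)))"
  \<comment> \<open>The second quotient is estimated at the base point \<open>e + t\<close>, which
    explains \<open>norm (e - 1) + \<rho>\<close>; the last factor bounds
    \<open>norm (c + e + 2 * r)\<close> relative to \<open>r + 1\<close>.\<close>
  define C where "C = K (norm (c - 1)) * K (norm (e - 1) + \<rho>) * (norm c + norm e + 2)"
  have "C \<ge> 0" by (simp add: C_def K_def)
  moreover have "norm (damping c e t (Suc r) - damping c e t r)
      \<le> C * norm t * (fact r / pochhammer (1 + 2 * \<delta>) r / (real r + 1))"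
    if t: "norm t \<le> \<rho>" and \<delta>: "0 \<le> \<delta>" "\<delta> \<le> Re t" for t r \<delta>
  proof -
    define n where "n = real r + 1"
    have n: "n \<ge> 1" by (simp add: n_def)
    have nc: "norm (c + of_nat r) \<ge> n"
      using complex_Re_le_cmod[of "c + of_nat r"] c by (simp add: n_def)
    have ne: "norm (e + t + of_nat r) \<ge> n"
      using complex_Re_le_cmod[of "e + t + of_nat r"] e \<delta> by (simp add: n_def)
    have nz: "c + of_nat r \<noteq> 0" "e + t + of_nat r \<noteq> 0" using nc ne n by auto
    have "damping c e t (Suc r) = damping c e t r
        * ((c - t + of_nat r) / (c + of_nat r) * ((e + of_nat r) / (e + t + of_nat r)))"
      by (simp add: damping_def pochhammer_Suc mult_ac)
    also have "(c - t + of_nat r) / (c + of_nat r) * ((e + of_nat r) / (e + t + of_nat r))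
        = 1 - t * (c + e + 2 * of_nat r) / ((c + of_nat r) * (e + t + of_nat r))"
      using nz by (simp add: divide_simps) (simp add: algebra_simps)
    finally have diff: "damping c e t (Suc r) - damping c e t r
        = - (damping c e t r * (t * (c + e + 2 * of_nat r) / ((c + of_nat r) * (e + t + of_nat r))))"
      by (simp add: algebra_simps)
    have harm: "harm r \<ge> (0 :: real)" by (rule harm_nonneg)
    have "norm (damping c e t r) \<le> (K (norm (c - 1)) * exp (- (Re t * harm r)))
        * (K (norm (e - 1) + \<rho>) * exp (- (Re t * harm r)))"
      unfolding damping_def norm_mult
    proof (intro mult_mono)
      show "norm (pochhammer (c - t) r / pochhammer c r) \<le> K (norm (c - 1)) * exp (- (Re t * harm r))"
        unfolding K_def by (rule norm_pochhammer_ratio_le[OF c t]) simp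
      have "norm (e + t - 1) \<le> norm (e - 1) + \<rho>"
        using norm_triangle_ineq[of "e - 1" t] t by (simp add: algebra_simps)
      then show "norm (pochhammer e r / pochhammer (e + t) r) \<le> K (norm (e - 1) + \<rho>) * exp (- (Re t * harm r))"
        using norm_pochhammer_ratio_le[of "e + t" t \<rho> "norm (e - 1) + \<rho>" r] e t \<delta> by (simp add: K_def)
    qed (auto simp: K_def)
    also have "\<dots> = K (norm (c - 1)) * K (norm (e - 1) + \<rho>) * exp (- (2 * Re t * harm r))"
      by (simp add: mult_ac flip: exp_add)
    also have "\<dots> \<le> K (norm (c - 1)) * K (norm (e - 1) + \<rho>) * (fact r / pochhammer (1 + 2 * \<delta>) r)"
    proof (intro mult_left_mono)
      have "exp (- (2 * Re t * harm r)) \<le> exp (- (2 * \<delta> * harm r))"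
        using \<delta> harm by (simp add: mult_right_mono)
      also have "\<dots> \<le> fact r / pochhammer (1 + 2 * \<delta>) r"
        using \<delta> by (intro exp_minus_harm_le) auto
      finally show "exp (- (2 * Re t * harm r)) \<le> fact r / pochhammer (1 + 2 * \<delta>) r" .
    qed (auto simp: K_def)
    finally have d: "norm (damping c e t r) \<le> \<dots>" .
    have "norm (c + e + 2 * of_nat r) \<le> norm c + norm e + 2 * real r"
      by (metis (no_types, opaque_lifting) norm_triangle_le norm_triangle_ineq add_mono norm_mult norm_numeral norm_of_nat order_refl)
    also have "\<dots> \<le> (norm c + norm e + 2) * n"
      using mult_left_mono[OF n, of "norm c + norm e"] by (simp add: n_def algebra_simps)
    finally have q: "norm (t * (c + e + 2 * of_nat r) / ((c + of_nat r) * (e + t + of_nat r)))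
        \<le> norm t * ((norm c + norm e + 2) * n) / (n * n)"
      unfolding norm_divide norm_mult using nc ne n
      by (intro frac_le mult_mono) auto
    have "norm (damping c e t (Suc r) - damping c e t r)
        \<le> (K (norm (c - 1)) * K (norm (e - 1) + \<rho>) * (fact r / pochhammer (1 + 2 * \<delta>) r))
          * (norm t * ((norm c + norm e + 2) * n) / (n * n))"
      unfolding diff norm_minus_cancel norm_mult[of "damping c e t r"]
      by (intro mult_mono d q) (use norm_ge_zero d order_trans in blast)+
    also have "\<dots> = C * norm t * (fact r / pochhammer (1 + 2 * \<delta>) r / n)"
      using n by (simp add: C_def)
    finally show ?thesis by (simp add: n_def)
  qed
  ultimately show ?thesis by (rule that)
qed

lemma pochhammer_neq_0:
  assumes "(z :: complex) \<notin> \<int>\<^sub>\<le>\<^sub>0"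
  shows "pochhammer z n \<noteq> 0"
  using assms pochhammer_eq_0_imp_nonpos_Int by blast

lemma nonpos_Ints_complex_Re: "(z :: complex) \<in> \<int>\<^sub>\<le>\<^sub>0 \<Longrightarrow> Re z \<le> 0"
  by (auto elim!: nonpos_Ints_cases)

lemma holomorphic_damping:
  assumes "Re e > 0"
  shows "(\<lambda>t. damping c e t r) holomorphic_on {t. Re t > - Re e}"
proof -
  have "pochhammer (e + t) r \<noteq> 0" if "Re t > - Re e" for t
    using that nonpos_Ints_complex_Re[of "e + t"] by (intro pochhammer_neq_0) auto
  then show ?thesis
    unfolding damping_def divide_inverse[of "pochhammer (c - _) _"] by (intro holomorphic_intros) auto
qed

lemma summable_fact_over_pochhammer:
  assumes "\<tau> > 0"
  shows "summable (\<lambda>r. fact r / pochhammer (1 + \<tau> :: real) r / (real r + 1))"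
proof (rule summableI_nonneg_bounded)
  show "0 \<le> fact r / pochhammer (1 + \<tau>) r / (real r + 1)" for r
    using assms by (intro divide_nonneg_nonneg pochhammer_nonneg) auto
  show "(\<Sum>r<N. fact r / pochhammer (1 + \<tau>) r / (real r + 1)) \<le> (1 + \<tau>) / \<tau>" for N
    using sum_fact_over_pochhammer_le[of \<tau> N] assms by (simp add: field_simps)
qed

text \<open>Summation by parts expresses the damped series through the increments of
  \<open>damping\<close>; that series converges locally uniformly for \<open>Re t > 0\<close>, hence
  is holomorphic. The limit at 0 is an instance of
  \<open>tendsto_suminf_bounded_variation\<close>.\<close>

lemma damped_series:
  assumes c: "Re c \<ge> 1" and e: "Re e \<ge> 1" and A: "A sums S"
  obtains L where "L holomorphic_on {t. Re t > 0}"
    and "\<And>t. Re t > 0 \<Longrightarrow> (\<lambda>r. A r * damping c e t r) sums L t"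
    and "((\<lambda>x. L (of_real x)) \<longlongrightarrow> S) (at_right 0)"
proof -
  define P where "P = (\<lambda>\<tau> r. fact r / pochhammer (1 + \<tau> :: real) r / (real r + 1))"
  define \<Delta> where "\<Delta> = (\<lambda>r t. damping c e t (Suc r) - damping c e t r)"
  define T where "T = (\<lambda>r. S - (\<Sum>k\<le>r. A k))"
  define L where "L = (\<lambda>t. \<Sum>r. A r * damping c e t r)"
  have Psum: "summable (P (2 * \<delta>))" if "\<delta> > 0" for \<delta>
    using summable_fact_over_pochhammer[of "2 * \<delta>"] that by (simp add: P_def)
  have \<Delta>sum: "summable (\<lambda>r. norm (\<Delta> r t))" if t: "Re t > 0" for t
  proof -
    obtain C where "C \<ge> 0" and C: "\<And>u r \<delta>. norm u \<le> norm t \<Longrightarrow> 0 \<le> \<delta> \<Longrightarrow> \<delta> \<le> Re u \<Longrightarrow>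
        norm (\<Delta> r u) \<le> C * norm u * P (2 * \<delta>) r"
      using damping_variation[OF c e norm_ge_zero[of t]] unfolding \<Delta>_def P_def by blast
    show ?thesis
      by (rule summable_comparison_test'[OF summable_mult[OF Psum[OF t], of "C * norm t"]])
         (use C[of t "Re t"] t in simp)
  qed
  have bv: "(\<lambda>r. A r * damping c e t r) sums (S + (\<Sum>r. T r * \<Delta> r t))" if "Re t > 0" for t
    using sums_mult_bounded_variation(2)[OF A, of "damping c e t"] \<Delta>sum[OF that]
    by (simp add: T_def \<Delta>_def)
  have sums: "(\<lambda>r. A r * damping c e t r) sums L t" if "Re t > 0" for t
    using bv[OF that] by (simp add: L_def sums_iff)
  have L: "L t = S + (\<Sum>r. T r * \<Delta> r t)" if "Re t > 0" for t
    using sums_unique[OF bv[OF that]] by (simp add: L_def)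
  have "T \<longlonglongrightarrow> S - S"
    unfolding T_def using A by (intro tendsto_intros) (simp add: sums_def_le)
  then obtain K where K: "norm (T r) \<le> K" for r
    using convergent_imp_Bseq[of T] unfolding convergent_def Bseq_def by blast
  then have K0: "K \<ge> 0" using norm_ge_zero order_trans by blast
  define U where "U = {t. Re t > 0}"
  have "open U" by (simp add: U_def open_halfspace_Re_gt)
  have dhol: "(\<lambda>t. damping c e t r) holomorphic_on {t. Re t > - Re e}" for r
    using e by (intro holomorphic_damping) auto
  have "(\<lambda>t. \<Sum>r. T r * \<Delta> r t) holomorphic_on U"
  proof (rule holomorphic_on_suminf[OF \<open>open U\<close>])
    have "(\<lambda>t. damping c e t r) holomorphic_on U" for r
      by (rule holomorphic_on_subset[OF dhol]) (use e in \<open>auto simp: U_def\<close>)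
    then show "(\<lambda>t. T r * \<Delta> r t) holomorphic_on U" for r
      unfolding \<Delta>_def by (intro holomorphic_intros)
    fix x assume "x \<in> U"
    \<comment> \<open>Half the distance to the imaginary axis: on the closed disc
      \<open>Re t\<close> stays at least \<open>d\<close>, so \<open>d\<close> serves as the
      \<delta> of \<open>damping_variation\<close>.\<close>
    define d where "d = Re x / 2"
    have d: "d > 0" using \<open>x \<in> U\<close> by (simp add: U_def d_def)
    have Re: "d \<le> Re t" if "t \<in> cball x d" for t
      using that abs_Re_le_cmod[of "x - t"] by (simp add: dist_norm d_def)
    have nt: "norm t \<le> norm x + d" if "t \<in> cball x d" for t
      using that norm_triangle_sub[of t x] by (simp add: dist_norm norm_minus_commute)
    have x0: "0 \<le> norm x + d" using d by (simp add: add_nonneg_nonneg)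
    obtain C where "C \<ge> 0" and C: "\<And>u r \<delta>. norm u \<le> norm x + d \<Longrightarrow> 0 \<le> \<delta> \<Longrightarrow> \<delta> \<le> Re u \<Longrightarrow>
        norm (\<Delta> r u) \<le> C * norm u * P (2 * \<delta>) r"
      using damping_variation[OF c e x0] unfolding \<Delta>_def P_def by blast
    have P0: "P (2 * d) r \<ge> 0" for r
      unfolding P_def using d by (intro divide_nonneg_nonneg pochhammer_nonneg) auto
    have "norm (T r * \<Delta> r t) \<le> K * (C * (norm x + d) * P (2 * d) r)" if "t \<in> cball x d" for r t
    proof -
      have "norm (\<Delta> r t) \<le> C * norm t * P (2 * d) r"
        using C[of t d r] Re[OF that] nt[OF that] d by simp
      also have "\<dots> \<le> C * (norm x + d) * P (2 * d) r"
        using nt[OF that] \<open>C \<ge> 0\<close> P0 by (intro mult_right_mono mult_left_mono) auto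
      finally show ?thesis
        unfolding norm_mult using K[of r] K0 by (intro mult_mono) auto
    qed
    moreover have "cball x d \<subseteq> U" using Re d by (force simp: U_def)
    moreover have "summable (\<lambda>r. K * (C * (norm x + d) * P (2 * d) r))"
      by (intro summable_mult Psum d)
    ultimately show "\<exists>d>0. \<exists>M. cball x d \<subseteq> U \<and> summable M \<and> (\<forall>n. \<forall>t\<in>cball x d. norm (T n * \<Delta> n t) \<le> M n)"
      using d by blast
  qed
  then have "(\<lambda>t. S + (\<Sum>r. T r * \<Delta> r t)) holomorphic_on U"
    by (intro holomorphic_intros)
  then have Lhol: "L holomorphic_on U"
    by (rule holomorphic_transform) (simp add: L U_def)
  obtain C where "C \<ge> 0" and C: "\<And>u r \<delta>. norm u \<le> 1 \<Longrightarrow> 0 \<le> \<delta> \<Longrightarrow> \<delta> \<le> Re u \<Longrightarrow>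
      norm (\<Delta> r u) \<le> C * norm u * P (2 * \<delta>) r"
    using damping_variation[OF c e zero_le_one] unfolding \<Delta>_def P_def by blast
  have lim: "((\<lambda>x. L (of_real x)) \<longlongrightarrow> S) (at_right 0)"
    unfolding L_def
  proof (rule tendsto_suminf_bounded_variation[OF A])
    fix r
    have "pochhammer c r \<noteq> 0" "pochhammer e r \<noteq> 0"
      using c e nonpos_Ints_complex_Re[of c] nonpos_Ints_complex_Re[of e] by (intro pochhammer_neq_0; auto)+
    then have d0: "damping c e 0 r = 1" by (simp add: damping_def)
    have "isCont (\<lambda>t. damping c e t r) 0"
      using holomorphic_on_imp_continuous_on[OF dhol] e
      by (auto simp: continuous_on_eq_continuous_at open_halfspace_Re_gt)
    then have "((\<lambda>x. damping c e (of_real x) r) \<longlongrightarrow> damping c e 0 r) (at_right 0)"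
      by (rule isCont_tendsto_compose) (auto intro!: tendsto_eq_intros)
    then show "((\<lambda>x. damping c e (of_real x) r) \<longlongrightarrow> 1) (at_right 0)"
      by (simp add: d0)
  next
    have "\<forall>\<^sub>F x in at_right (0::real). 0 < x \<and> x < 1"
      by (auto simp: eventually_at_right_field intro!: exI[of _ 1])
    then show "\<forall>\<^sub>F x in at_right 0. \<forall>N. (\<Sum>r<N. norm (damping c e (of_real x) (Suc r) - damping c e (of_real x) r)) \<le> C * 3"
    proof eventually_elim
      case (elim x)
      show ?case
      proof
        fix N
        \<comment> \<open>For real \<open>x > 0\<close> both \<open>norm t\<close> and \<delta>
          equal \<open>x\<close>; the factor \<open>norm t\<close> thus compensates for the growth
          of the sum as \<open>x\<close> tends to 0.\<close>
        have "(\<Sum>r<N. norm (\<Delta> r (of_real x))) \<le> (\<Sum>r<N. C * x * P (2 * x) r)"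
          using elim C[of "of_real x" x] by (intro sum_mono) auto
        also have "\<dots> = C / 2 * (2 * x * (\<Sum>r<N. P (2 * x) r))"
          by (simp add: sum_distrib_left mult_ac)
        also have "\<dots> \<le> C / 2 * (1 + 2 * x)"
          unfolding P_def using elim \<open>C \<ge> 0\<close> by (intro mult_left_mono sum_fact_over_pochhammer_le) auto
        also have "\<dots> \<le> C / 2 * 6"
          using elim \<open>C \<ge> 0\<close> by (intro mult_left_mono) auto
        finally show "(\<Sum>r<N. norm (damping c e (of_real x) (Suc r) - damping c e (of_real x) r)) \<le> C * 3"
          by (simp add: \<Delta>_def)
      qed
    qed
  qed
  show ?thesis
    using that[of L] Lhol sums lim by (simp add: U_def)
qed

section \<open>Removal of the restrictions on real parts\<close>

lemma nat_shift_Re_ge_1: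
  obtains m :: nat where "Re (c + of_nat m) \<ge> 1" and "Re (e + of_nat m) \<ge> 1"
proof -
  obtain m :: nat where "max (1 - Re c) (1 - Re e) \<le> real m"
    using real_arch_simple by blast
  then show ?thesis by (intro that[of m]) auto
qed

lemma rGamma_eq_over_pochhammer:
  assumes "(z :: complex) \<notin> \<int>\<^sub>\<le>\<^sub>0"
  shows "rGamma (z + of_nat n) = rGamma z / pochhammer z n"
  using pochhammer_rGamma[of z n] pochhammer_neq_0[OF assms, of n] by (simp add: field_simps)

text \<open>From an index \<open>m\<close> on, the factor is its value at \<open>m\<close> times a
  \<open>damping\<close> with both parameters shifted by \<open>m\<close>, to which
  \<open>damped_series\<close> applies; the first \<open>m\<close> terms are entire in
  \<open>t\<close>. The quotient \<open>pochhammer e r / pochhammer (e + t) r\<close> could have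
  poles in the half-plane, whereas the \<open>rGamma\<close> form has none.\<close>

lemma damped_series_rGamma:
  assumes c: "c \<notin> \<int>\<^sub>\<le>\<^sub>0" and e: "e \<notin> \<int>\<^sub>\<le>\<^sub>0" and A: "A sums S"
  obtains L where "L holomorphic_on {t. Re t > 0}"
    and "\<And>t. Re t > 0 \<Longrightarrow> (\<lambda>r. A r * (pochhammer (c - t) r / pochhammer c r
           * (rGamma (e + t + of_nat r) / rGamma (e + of_nat r)))) sums L t"
    and "((\<lambda>x. L (of_real x)) \<longlongrightarrow> S) (at_right 0)"
proof -
  obtain m where m: "Re (c + of_nat m) \<ge> 1" "Re (e + of_nat m) \<ge> 1"
    using nat_shift_Re_ge_1 by blast
  define g where "g = (\<lambda>r t. pochhammer (c - t) r / pochhammer c r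
           * (rGamma (e + t + of_nat r) / rGamma (e + of_nat r)))"
  have "(\<lambda>r. A (r + m)) sums (S - (\<Sum>r<m. A r))"
    using A by (rule sums_split_initial_segment)
  with m obtain L where L: "L holomorphic_on {t. Re t > 0}"
    "\<And>t. Re t > 0 \<Longrightarrow> (\<lambda>r. A (r + m) * damping (c + of_nat m) (e + of_nat m) t r) sums L t"
    "((\<lambda>x. L (of_real x)) \<longlongrightarrow> S - (\<Sum>r<m. A r)) (at_right 0)"
    using damped_series by blast
  have g: "g (r + m) t = g m t * damping (c + of_nat m) (e + of_nat m) t r" if "Re t > 0" for r t
  proof -
    have "e + of_nat m \<notin> \<int>\<^sub>\<le>\<^sub>0" "e + t + of_nat m \<notin> \<int>\<^sub>\<le>\<^sub>0"
      using m that nonpos_Ints_complex_Re[of "e + of_nat m"] nonpos_Ints_complex_Re[of "e + t + of_nat m"]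
      by auto
    note R = this[THEN rGamma_eq_over_pochhammer, of r]
    have p: "pochhammer (c - t) (r + m) = pochhammer (c - t) m * pochhammer (c + of_nat m - t) r"
      "pochhammer c (r + m) = pochhammer c m * pochhammer (c + of_nat m) r"
      using pochhammer_product'[of "c - t" m r] pochhammer_product'[of c m r]
      by (simp_all add: algebra_simps)
    have q: "e + t + of_nat (r + m) = e + t + of_nat m + of_nat r"
      "e + of_nat (r + m) = e + of_nat m + of_nat r" "e + of_nat m + t = e + t + of_nat m" by simp_all
    show ?thesis
      unfolding g_def damping_def p q R by (simp add: mult_ac)
  qed
  define L' where "L' = (\<lambda>t. (\<Sum>r<m. A r * g r t) + g m t * L t)"
  have rG: "rGamma (e + of_nat r) \<noteq> 0" for r
    using pochhammer_rGamma[of e r] rGamma_eq_zero_iff[of e] e by (metis mult_zero_right)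
  have ghol: "g r holomorphic_on B" for r B
    unfolding g_def using pochhammer_neq_0[OF c, of r] rG[of r]
    by (intro holomorphic_intros) auto
  have glim: "((\<lambda>x. g r (of_real x)) \<longlongrightarrow> 1) (at_right 0)" for r
  proof -
    have "isCont (g r) 0"
      using holomorphic_on_imp_continuous_on[OF ghol[of r UNIV]]
      by (simp add: continuous_on_eq_continuous_at)
    then have "((\<lambda>x. g r (of_real x)) \<longlongrightarrow> g r 0) (at_right 0)"
      by (rule isCont_tendsto_compose) (auto intro!: tendsto_eq_intros)
    moreover have "g r 0 = 1" using pochhammer_neq_0[OF c, of r] rG[of r] by (simp add: g_def)
    ultimately show ?thesis by simp
  qed
  have "L' holomorphic_on {t. Re t > 0}"
    unfolding L'_def by (intro holomorphic_intros ghol L)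
  moreover have "(\<lambda>r. A r * g r t) sums L' t" if "Re t > 0" for t
  proof -
    have "(\<lambda>r. A (r + m) * g (r + m) t) sums (g m t * L t)"
      using sums_mult[OF L(2)[OF that], of "g m t"] by (simp add: g that mult_ac)
    then show ?thesis
      using sums_iff_shift[of "\<lambda>r. A r * g r t" m] by (simp add: L'_def add_ac)
  qed
  moreover have "((\<lambda>x. L' (of_real x)) \<longlongrightarrow> (\<Sum>r<m. A r * 1) + 1 * (S - (\<Sum>r<m. A r))) (at_right 0)"
    unfolding L'_def by (intro tendsto_intros glim L)
  ultimately show ?thesis using that[of L'] by (simp add: g_def)
qed

text \<open>Compactness of the disc handles the finitely many indices up to \<open>m\<close>; beyond
  \<open>m\<close> the real part of the shifted parameter is at least 1 and
  \<open>norm_pochhammer_ratio_le\<close> applies.\<close>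

lemma norm_pochhammer_shift_bounded:
  assumes c: "(c :: complex) \<notin> \<int>\<^sub>\<le>\<^sub>0"
  obtains B where "\<And>t r. norm t \<le> \<rho> \<Longrightarrow> 0 \<le> Re t \<Longrightarrow> norm (pochhammer (c - t) r / pochhammer c r) \<le> B"
proof -
  define h where "h = (\<lambda>r t. pochhammer (c - t) r / pochhammer c r)"
  obtain m :: nat where m: "Re (c + of_nat m) \<ge> 1" using nat_shift_Re_ge_1 by blast
  have "\<exists>B. \<forall>t\<in>cball 0 \<rho>. norm (h r t) \<le> B" for r
  proof -
    have "h r holomorphic_on UNIV"
      unfolding h_def using pochhammer_neq_0[OF c] by (intro holomorphic_intros) auto
    then have "compact (h r ` cball 0 \<rho>)"
      by (intro compact_continuous_image holomorphic_on_imp_continuous_on) (auto intro: holomorphic_on_subset)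
    then have "bounded (h r ` cball 0 \<rho>)" by (rule compact_imp_bounded)
    then show ?thesis by (auto simp: bounded_iff)
  qed
  then have "\<forall>r. \<exists>B. \<forall>t\<in>cball 0 \<rho>. norm (h r t) \<le> B" ..
  from choice[OF this] obtain B where "\<forall>r. \<forall>t\<in>cball 0 \<rho>. norm (h r t) \<le> B r" ..
  then have B: "norm (h r t) \<le> B r" if "t \<in> cball 0 \<rho>" for r t using that by simp
  define E where "E = exp ((\<rho> * norm (c + of_nat m - 1) + \<rho>\<^sup>2 / 2) * (pi\<^sup>2 / 6))"
  have "norm (h r t) \<le> (\<Sum>r<m. \<bar>B r\<bar>) + \<bar>B m\<bar> * E" if t: "norm t \<le> \<rho>" "0 \<le> Re t" for r t
  proof (cases "r < m")
    case True
    have "norm (h r t) \<le> \<bar>B r\<bar>" using B[of t r] t by simp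
    also have "\<dots> \<le> (\<Sum>r<m. \<bar>B r\<bar>)" using True by (intro member_le_sum) auto
    finally show ?thesis by (simp add: E_def add_increasing2)
  next
    case False
    then obtain k where k: "r = m + k" using le_Suc_ex not_less by blast
    have "h r t = h m t * (pochhammer (c + of_nat m - t) k / pochhammer (c + of_nat m) k)"
      unfolding h_def k pochhammer_product' by (simp add: diff_add_eq)
    moreover have "norm (pochhammer (c + of_nat m - t) k / pochhammer (c + of_nat m) k) \<le> E * 1"
    proof -
      have "norm (pochhammer (c + of_nat m - t) k / pochhammer (c + of_nat m) k) \<le> E * exp (- (Re t * harm k))"
        unfolding E_def by (rule norm_pochhammer_ratio_le[OF m t(1)]) simp
      also have "\<dots> \<le> E * 1"
        using t by (intro mult_left_mono) (auto simp: E_def harm_nonneg)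
      finally show ?thesis .
    qed
    moreover have "norm (h m t) \<le> \<bar>B m\<bar>" using B[of t m] t by simp
    ultimately have "norm (h r t) \<le> \<bar>B m\<bar> * E"
      by (simp only: norm_mult mult_1_right) (intro mult_mono, auto)
    then show ?thesis by (simp add: add_increasing sum_nonneg)
  qed
  then show ?thesis using that by (auto simp: h_def)
qed

text \<open>The counterpart of \<open>damped_series_rGamma\<close> for the \<beta> side, where
  \<open>c\<close> enters only through one Pochhammer symbol. Absolute convergence and bounded
  factors suffice here, so Tannery's theorem gives the limit without any estimate of
  variation.\<close>

lemma shifted_series:
  assumes c: "c \<notin> \<int>\<^sub>\<le>\<^sub>0" and u: "summable (\<lambda>r. norm (u r))"
  obtains L where "L holomorphic_on {t. Re t > 0}"
    and "\<And>t. Re t > 0 \<Longrightarrow> summable (\<lambda>r. norm (u r * (pochhammer (c - t) r / pochhammer c r)))"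
    and "\<And>t. Re t > 0 \<Longrightarrow> (\<lambda>r. u r * (pochhammer (c - t) r / pochhammer c r)) sums L t"
    and "((\<lambda>x. L (of_real x)) \<longlongrightarrow> (\<Sum>r. u r)) (at_right 0)"
proof -
  define h where "h = (\<lambda>r t. pochhammer (c - t) r / pochhammer c r)"
  have bound: "\<exists>B. \<forall>t r. norm t \<le> \<rho> \<longrightarrow> 0 \<le> Re t \<longrightarrow> norm (u r * h r t) \<le> B * norm (u r)" for \<rho>
  proof -
    obtain B where "\<And>t r. norm t \<le> \<rho> \<Longrightarrow> 0 \<le> Re t \<Longrightarrow> norm (h r t) \<le> B"
      using norm_pochhammer_shift_bounded[OF c] unfolding h_def by blast
    then show ?thesis
      by (intro exI[of _ B]) (auto simp: norm_mult mult.commute[of B] intro!: mult_left_mono)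
  qed
  have abs: "summable (\<lambda>r. norm (u r * h r t))" if "Re t > 0" for t
  proof -
    obtain B where "\<forall>x r. norm x \<le> norm t \<longrightarrow> 0 \<le> Re x \<longrightarrow> norm (u r * h r x) \<le> B * norm (u r)"
      using bound by blast
    then show ?thesis
      using that by (intro summable_comparison_test'[OF summable_mult[OF u, of B]]) auto
  qed
  define L where "L = (\<lambda>t. \<Sum>r. u r * h r t)"
  define U where "U = {t. Re t > 0}"
  have "open U" by (simp add: U_def open_halfspace_Re_gt)
  have hhol: "h r holomorphic_on B" for r B
    unfolding h_def using pochhammer_neq_0[OF c] by (intro holomorphic_intros) auto
  have "L holomorphic_on U"
    unfolding L_def
  proof (rule holomorphic_on_suminf[OF \<open>open U\<close>])
    show "(\<lambda>t. u r * h r t) holomorphic_on U" for r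
      by (intro holomorphic_intros hhol)
    fix x assume "x \<in> U"
    then obtain d where d: "d > 0" "cball x d \<subseteq> U"
      using \<open>open U\<close> open_contains_cball by blast
    obtain B where B: "\<forall>t r. norm t \<le> norm x + d \<longrightarrow> 0 \<le> Re t \<longrightarrow> norm (u r * h r t) \<le> B * norm (u r)"
      using bound by blast
    have "norm (u r * h r t) \<le> B * norm (u r)" if "t \<in> cball x d" for r t
    proof -
      have "norm t \<le> norm x + d"
        using that norm_triangle_sub[of t x] by (simp add: dist_norm norm_minus_commute)
      moreover have "0 \<le> Re t" using that d by (auto simp: U_def)
      ultimately show ?thesis using B by blast
    qed
    moreover have "summable (\<lambda>r. B * norm (u r))" by (intro summable_mult u)
    ultimately show "\<exists>d>0. \<exists>M. cball x d \<subseteq> U \<and> summable M \<and> (\<forall>n. \<forall>t\<in>cball x d. norm (u n * h n t) \<le> M n)"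
      using d by blast
  qed
  moreover have "((\<lambda>x. L (of_real x)) \<longlongrightarrow> (\<Sum>r. u r)) (at_right 0)"
  proof -
    obtain B where B: "\<forall>t r. norm t \<le> 1 \<longrightarrow> 0 \<le> Re t \<longrightarrow> norm (u r * h r t) \<le> B * norm (u r)"
      using bound by blast
    have "((\<lambda>x. u r * h r (of_real x)) \<longlongrightarrow> u r) (at_right 0)" for r
    proof -
      have "isCont (h r) 0"
        using holomorphic_on_imp_continuous_on[OF hhol[of r UNIV]]
        by (simp add: continuous_on_eq_continuous_at)
      then have "((\<lambda>x. h r (of_real x)) \<longlongrightarrow> h r 0) (at_right 0)"
        by (rule isCont_tendsto_compose) (auto intro!: tendsto_eq_intros)
      moreover have "h r 0 = 1" using pochhammer_neq_0[OF c] by (simp add: h_def)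
      ultimately show ?thesis using tendsto_mult[OF tendsto_const[of "u r"]] by fastforce
    qed
    moreover have "\<forall>\<^sub>F (r, x) in at_top \<times>\<^sub>F at_right 0. norm (u r * h r (of_real x)) \<le> B * norm (u r)"
    proof -
      have "\<forall>\<^sub>F x in at_right (0::real). 0 < x \<and> x < 1"
        by (auto simp: eventually_at_right_field intro!: exI[of _ 1])
      then have "\<forall>\<^sub>F x in at_right 0. \<forall>r. norm (u r * h r (of_real x)) \<le> B * norm (u r)"
        by eventually_elim (use B in auto)
      then show ?thesis
        unfolding eventually_prod_filter
        by (intro exI[of _ "\<lambda>_. True"] exI[of _ "\<lambda>x. \<forall>r. norm (u r * h r (of_real x)) \<le> B * norm (u r)"]) auto
    qed
    ultimately show ?thesis
      unfolding L_def
      using tannerys_theorem[of "\<lambda>r x. u r * h r (of_real x)" u "at_right 0" "\<lambda>r. B * norm (u r)"]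
        summable_mult[OF u, of B] by auto
  qed
  moreover have "(\<lambda>r. u r * h r t) sums L t" if "Re t > 0" for t
    using summable_norm_cancel[OF abs[OF that]] by (simp add: L_def sums_iff)
  ultimately show ?thesis
    using that[of L] abs by (simp add: U_def h_def)
qed

section \<open>Passing to the limit in the finite transformation\<close>

text \<open>For \<open>n > 0\<close> this is the power of \<open>n\<close> with exponent
  \<open>z\<close>, in the shape that occurs in \<open>rGamma_series\<close>.\<close>

definition exp_ln :: "complex \<Rightarrow> nat \<Rightarrow> complex" where
  "exp_ln z n = exp (z * of_real (ln (real n)))"

lemma exp_ln_add: "exp_ln (z + w) n = exp_ln z n * exp_ln w n"
  by (simp add: exp_ln_def distrib_right exp_add)

lemma exp_ln_diff: "exp_ln (z - w) n = exp_ln z n / exp_ln w n"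
  by (simp add: exp_ln_def left_diff_distrib exp_diff)

lemma exp_ln_1: "n > 0 \<Longrightarrow> exp_ln 1 n = of_nat n"
  by (simp add: exp_ln_def exp_of_real)

lemma exp_ln_neq_0 [simp]: "exp_ln z n \<noteq> 0"
  by (simp add: exp_ln_def)

lemma exp_ln_0 [simp]: "exp_ln 0 n = 1"
  by (simp add: exp_ln_def)

lemma norm_exp_ln: "norm (exp_ln z n) = exp (Re z * ln (real n))"
  by (simp add: exp_ln_def)

lemma tendsto_add_over_of_nat: "(\<lambda>n. (z + of_nat n) / of_nat n :: complex) \<longlonglongrightarrow> 1"
proof -
  have "(\<lambda>n. z * inverse (of_nat n) + 1) \<longlonglongrightarrow> z * 0 + 1"
    by (intro tendsto_intros lim_inverse_n)
  moreover have "\<forall>\<^sub>F n in sequentially. z * inverse (of_nat n) + 1 = (z + of_nat n) / of_nat n"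
    using eventually_gt_at_top[of 0] by eventually_elim (simp add: field_simps)
  ultimately show ?thesis by (simp add: tendsto_cong)
qed

text \<open>Off the poles this is the limit of \<open>rGamma_series\<close>. A general
  \<open>z\<close> is reached downwards from some \<open>z + m\<close> by the functional equation,
  whose extra factor \<open>(z + n) / n\<close> tends to 1.\<close>

lemma rGamma_shift_asymp:
  fixes z :: complex
  shows "(\<lambda>n. rGamma (z + of_nat n) * fact n * exp_ln (z - 1) n) \<longlonglongrightarrow> 1"
proof -
  have step: "(\<lambda>n. rGamma (z + of_nat n) * fact n * exp_ln (z - 1) n) \<longlonglongrightarrow> 1"
    if "(\<lambda>n. rGamma (z + 1 + of_nat n) * fact n * exp_ln (z + 1 - 1) n) \<longlonglongrightarrow> 1" for z :: complex
  proof -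
    have "(\<lambda>n. rGamma (z + 1 + of_nat n) * fact n * exp_ln (z + 1 - 1) n * ((z + of_nat n) / of_nat n)) \<longlonglongrightarrow> 1 * 1"
      by (intro tendsto_mult that tendsto_add_over_of_nat)
    moreover have "\<forall>\<^sub>F n in sequentially. rGamma (z + 1 + of_nat n) * fact n * exp_ln (z + 1 - 1) n * ((z + of_nat n) / of_nat n)
        = rGamma (z + of_nat n) * fact n * exp_ln (z - 1) n"
      using eventually_gt_at_top[of 0]
    proof eventually_elim
      case (elim n)
      have "rGamma (z + of_nat n) = (z + of_nat n) * rGamma (z + 1 + of_nat n)"
        using rGamma_plus1[of "z + of_nat n"] by (simp add: add_ac)
      then show ?case using elim by (simp add: exp_ln_diff exp_ln_1)
    qed
    ultimately show ?thesis by (simp add: tendsto_cong)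
  qed
  have base: "(\<lambda>n. rGamma (z + of_nat n) * fact n * exp_ln (z - 1) n) \<longlonglongrightarrow> 1"
    if z: "z \<notin> \<int>\<^sub>\<le>\<^sub>0" for z :: complex
  proof -
    have r0: "rGamma z \<noteq> 0" using z by (simp add: rGamma_eq_zero_iff)
    have "(\<lambda>n. rGamma z * inverse (rGamma_series z n) * ((z + of_nat n) / of_nat n)) \<longlonglongrightarrow> rGamma z * inverse (rGamma z) * 1"
      by (intro tendsto_intros tendsto_add_over_of_nat r0)
    moreover have "\<forall>\<^sub>F n in sequentially. rGamma z * inverse (rGamma_series z n) * ((z + of_nat n) / of_nat n)
        = rGamma (z + of_nat n) * fact n * exp_ln (z - 1) n"
      using eventually_gt_at_top[of 0]
    proof eventually_elim
      case (elim n)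
      have "z + of_nat n \<noteq> 0" using z pochhammer_neq_0[OF z, of "Suc n"] by (auto simp: pochhammer_Suc)
      then show ?case
        unfolding rGamma_eq_over_pochhammer[OF z] rGamma_series_def exp_ln_def[symmetric] exp_ln_diff exp_ln_1[OF elim]
        using elim pochhammer_neq_0[OF z, of n]
        by (simp add: pochhammer_Suc divide_simps)
    qed
    ultimately show ?thesis using r0 by (simp add: tendsto_cong)
  qed
  obtain m :: nat where m: "Re (z + of_nat m) \<ge> 1" using nat_shift_Re_ge_1 by blast
  have "(\<lambda>n. rGamma (z + of_nat m + of_nat n) * fact n * exp_ln (z + of_nat m - 1) n) \<longlonglongrightarrow> 1"
    using m nonpos_Ints_complex_Re[of "z + of_nat m"] by (intro base) auto
  then show ?thesis
  proof (induction m)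
    case (Suc m)
    show ?case
      by (rule Suc.IH, rule step) (use Suc.prems in \<open>simp add: add_ac\<close>)
  qed simp
qed

lemma pochhammer_over_fact_asymp:
  fixes d :: complex
  shows "(\<lambda>n. pochhammer d n / fact n * exp_ln (1 - d) n) \<longlonglongrightarrow> rGamma d"
proof -
  have "(\<lambda>n. rGamma_series d n * inverse ((d + of_nat n) / of_nat n)) \<longlonglongrightarrow> rGamma d * inverse 1"
    by (intro tendsto_intros tendsto_add_over_of_nat) auto
  moreover have "\<forall>\<^sub>F n in sequentially. d + of_nat n \<noteq> 0"
  proof -
    obtain m :: nat where m: "Re (d + of_nat m) \<ge> 1" using nat_shift_Re_ge_1 by blast
    then have "d + of_nat n \<noteq> 0" if "n \<ge> m" for n
      using that by (auto simp: complex_eq_iff)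
    then show ?thesis unfolding eventually_sequentially by blast
  qed
  then have "\<forall>\<^sub>F n in sequentially. rGamma_series d n * inverse ((d + of_nat n) / of_nat n)
      = pochhammer d n / fact n * exp_ln (1 - d) n"
    using eventually_gt_at_top[of 0]
  proof eventually_elim
    case (elim n)
    then show ?case
      unfolding rGamma_series_def exp_ln_def[symmetric] exp_ln_diff exp_ln_1[OF elim(2)]
      by (simp add: pochhammer_Suc divide_simps)
  qed
  ultimately show ?thesis by (simp add: tendsto_cong)
qed

text \<open>A fixed shift by \<open>r\<close> does not matter, because
  \<open>ln (n + r) - ln n\<close> tends to 0.\<close>

lemma pochhammer_over_fact_diff_asymp:
  fixes d :: complex
  shows "(\<lambda>n. pochhammer d (n - r) / fact (n - r) * exp_ln (1 - d) n) \<longlonglongrightarrow> rGamma d"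
proof (rule LIMSEQ_offset[where k = r])
  have "(\<lambda>n. ln (1 + real r / real n)) \<longlonglongrightarrow> ln (1 + 0)"
    by (intro tendsto_intros lim_const_over_n) auto
  moreover have "\<forall>\<^sub>F n in sequentially. ln (1 + real r / real n) = ln (real n + real r) - ln (real n)"
    using eventually_gt_at_top[of 0]
  proof eventually_elim
    case (elim n)
    then have "1 + real r / real n = (real n + real r) / real n" by (simp add: field_simps)
    then show ?case using elim by (simp add: ln_div)
  qed
  ultimately have "(\<lambda>n. ln (real n + real r) - ln (real n)) \<longlonglongrightarrow> 0"
    by (simp add: tendsto_cong)
  then have "(\<lambda>n. exp ((1 - d) * of_real (ln (real n + real r) - ln (real n)))) \<longlonglongrightarrow> exp ((1 - d) * of_real 0)"
    by (intro tendsto_intros)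
  then have "(\<lambda>n. pochhammer d n / fact n * exp_ln (1 - d) n
      * exp ((1 - d) * of_real (ln (real n + real r) - ln (real n)))) \<longlonglongrightarrow> rGamma d * 1"
    using tendsto_mult[OF pochhammer_over_fact_asymp[of d]] by fastforce
  moreover have "exp_ln (1 - d) n * exp ((1 - d) * of_real (ln (real n + real r) - ln (real n)))
      = exp_ln (1 - d) (n + r)" for n
    by (simp add: exp_ln_def right_diff_distrib flip: exp_add)
  ultimately show "(\<lambda>n. pochhammer d (n + r - r) / fact (n + r - r) * exp_ln (1 - d) (n + r)) \<longlonglongrightarrow> rGamma d"
    by (simp add: mult.assoc)
qed

text \<open>The factor that turns \<open>bailey_lemma_finite\<close> into a statement about convergent series.\<close>

definition bailey_factor :: "complex \<Rightarrow> complex \<Rightarrow> complex \<Rightarrow> nat \<Rightarrow> complex" where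
  "bailey_factor a b c n
     = fact n * (rGamma (1 + a - b + of_nat n) * rGamma (1 + a - c + of_nat n)) / rGamma (1 + a + of_nat n)"

lemma bailey_factor_asymp:
  "(\<lambda>n. bailey_factor a b c n * exp_ln (a - b - c) n) \<longlonglongrightarrow> 1"
proof -
  define x where "x = (\<lambda>z n. rGamma (z + of_nat n) * fact n * exp_ln (z - 1) n :: complex)"
  have e: "1 + a - b - 1 = a - b" "1 + a - c - 1 = a - c" "1 + a - 1 = a" by simp_all
  have "(\<lambda>n. x (1 + a - b) n * x (1 + a - c) n / x (1 + a) n) \<longlonglongrightarrow> 1 * 1 / 1"
    unfolding x_def by (intro tendsto_intros rGamma_shift_asymp) auto
  moreover have "bailey_factor a b c n * exp_ln (a - b - c) n = x (1 + a - b) n * x (1 + a - c) n / x (1 + a) n" for n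
    unfolding bailey_factor_def x_def e by (simp add: exp_ln_diff mult_ac)
  ultimately show ?thesis by simp
qed

text \<open>The exponents \<open>a - b - c\<close> and \<open>1 - (1 + a - b - c)\<close> of the two
  asymptotic formulas cancel.\<close>

lemma bailey_kernel_tendsto:
  "(\<lambda>n. bailey_factor a b c n * (pochhammer (1 + a - b - c) (n - r) / fact (n - r))) \<longlonglongrightarrow> rGamma (1 + a - b - c)"
proof -
  define d where "d = 1 + a - b - c"
  have lim: "(\<lambda>n. (bailey_factor a b c n * exp_ln (a - b - c) n)
      * (pochhammer d (n - r) / fact (n - r) * exp_ln (1 - d) n)) \<longlonglongrightarrow> 1 * rGamma d"
    by (intro tendsto_mult bailey_factor_asymp pochhammer_over_fact_diff_asymp)
  have one: "exp_ln (a - b - c) n * exp_ln (1 - d) n = 1" for n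
    by (simp add: d_def flip: exp_ln_add)
  have eq: "(bailey_factor a b c n * exp_ln (a - b - c) n)
      * (pochhammer d (n - r) / fact (n - r) * exp_ln (1 - d) n)
      = bailey_factor a b c n * (pochhammer d (n - r) / fact (n - r))" for n
  proof -
    have "x * e * (y * e') = x * y * (e * e')" for x y e e' :: complex by (simp only: mult_ac)
    from this[of _ "exp_ln (a - b - c) n" _ "exp_ln (1 - d) n"] show ?thesis
      unfolding one by simp
  qed
  show ?thesis using lim unfolding eq by (simp only: d_def mult_1_left)
qed

text \<open>With \<open>d = 1 + a - b - c\<close> the kernel has the order of
  \<open>(n - r) / n\<close> to the power \<open>Re d - 1\<close>, which is bounded over all
  \<open>r \<le> n\<close> because the exponent is nonnegative.\<close>

lemma bailey_kernel_bounded: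
  assumes "Re (1 + a - b - c) \<ge> 1"
  obtains C where "\<forall>\<^sub>F n in sequentially. \<forall>r\<le>n.
    norm (bailey_factor a b c n * (pochhammer (1 + a - b - c) (n - r) / fact (n - r))) \<le> C"
proof -
  define d where "d = 1 + a - b - c"
  define \<delta> where "\<delta> = Re d - 1"
  have \<delta>: "\<delta> \<ge> 0" using assms by (simp add: d_def \<delta>_def)
  have "Bseq (\<lambda>n. pochhammer d n / fact n * exp_ln (1 - d) n)"
    using pochhammer_over_fact_asymp[of d] by (intro convergent_imp_Bseq) (auto simp: convergent_def)
  then obtain K where K: "norm (pochhammer d n / fact n * exp_ln (1 - d) n) \<le> K" for n
    unfolding Bseq_def by blast
  have poch: "norm (pochhammer d (n - r) / fact (n - r)) \<le> (\<bar>K\<bar> + 1) * exp (\<delta> * ln (real n))"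
    if "n > 0" for n r
  proof (cases "n - r = 0")
    \<comment> \<open>The comparison of \<open>ln (n - r)\<close> with \<open>ln n\<close> in the
      other case needs \<open>n - r > 0\<close>.\<close>
    case True
    have "1 * 1 \<le> (\<bar>K\<bar> + 1) * exp (\<delta> * ln (real n))"
      using \<delta> that by (intro mult_mono) auto
    then show ?thesis by (simp add: True)
  next
    case False
    define m where "m = n - r"
    have m: "m > 0" "m \<le> n" using False by (auto simp: m_def)
    have e: "norm (exp_ln (1 - d) m) = exp (- (\<delta> * ln (real m)))" by (simp add: norm_exp_ln \<delta>_def algebra_simps)
    have "norm (pochhammer d m / fact m) * exp (- (\<delta> * ln (real m))) \<le> \<bar>K\<bar> + 1"
      using K[of m] unfolding norm_mult e by linarith
    then have "norm (pochhammer d m / fact m) \<le> (\<bar>K\<bar> + 1) * exp (\<delta> * ln (real m))"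
      by (simp add: exp_minus field_simps)
    also have "\<dots> \<le> (\<bar>K\<bar> + 1) * exp (\<delta> * ln (real n))"
      using m \<delta> by (intro mult_left_mono) (auto intro: mult_left_mono)
    finally show ?thesis by (simp add: m_def)
  qed
  have "\<forall>\<^sub>F n in sequentially. norm (bailey_factor a b c n * exp_ln (a - b - c) n) < 2"
    using tendsto_norm[OF bailey_factor_asymp[of a b c]] by (intro order_tendstoD) auto
  then have "\<forall>\<^sub>F n in sequentially. \<forall>r\<le>n.
    norm (bailey_factor a b c n * (pochhammer d (n - r) / fact (n - r))) \<le> 2 * (\<bar>K\<bar> + 1)"
    using eventually_gt_at_top[of 0]
  proof eventually_elim
    case (elim n)
    have "norm (exp_ln (a - b - c) n) = exp (\<delta> * ln (real n))"
      by (simp add: norm_exp_ln \<delta>_def d_def)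
    then have f: "norm (bailey_factor a b c n) * exp (\<delta> * ln (real n)) \<le> 2"
      using elim(1) by (simp add: norm_mult)
    show ?case
    proof (intro allI impI)
      fix r assume "r \<le> n"
      have "norm (bailey_factor a b c n * (pochhammer d (n - r) / fact (n - r)))
          \<le> norm (bailey_factor a b c n) * ((\<bar>K\<bar> + 1) * exp (\<delta> * ln (real n)))"
        unfolding norm_mult by (intro mult_left_mono poch elim norm_ge_zero)
      also have "\<dots> = norm (bailey_factor a b c n) * exp (\<delta> * ln (real n)) * (\<bar>K\<bar> + 1)"
        by (simp only: mult_ac)
      also have "\<dots> \<le> 2 * (\<bar>K\<bar> + 1)" by (intro mult_right_mono f) auto
      finally show "norm (bailey_factor a b c n * (pochhammer d (n - r) / fact (n - r))) \<le> 2 * (\<bar>K\<bar> + 1)" .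
    qed
  qed
  then show ?thesis using that by (simp add: d_def)
qed

text \<open>The first alternative serves parameters for which the series terminates, the second is
  Tannery's theorem with the bound of \<open>bailey_kernel_bounded\<close>.\<close>

lemma bailey_rhs_limit:
  assumes "(\<exists>N. \<forall>r\<ge>N. u r = 0) \<or> Re (1 + a - b - c) \<ge> 1 \<and> summable (\<lambda>r. norm (u r))"
  shows "(\<lambda>n. bailey_factor a b c n * (\<Sum>r\<le>n. pochhammer (1 + a - b - c) (n - r) / fact (n - r) * u r))
           \<longlonglongrightarrow> rGamma (1 + a - b - c) * (\<Sum>r. u r)"
proof -
  define k where "k = (\<lambda>r n. bailey_factor a b c n * (pochhammer (1 + a - b - c) (n - r) / fact (n - r)))"
  have k: "k r \<longlonglongrightarrow> rGamma (1 + a - b - c)" for r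
    unfolding k_def by (rule bailey_kernel_tendsto)
  have eq: "bailey_factor a b c n * (\<Sum>r\<le>n. pochhammer (1 + a - b - c) (n - r) / fact (n - r) * u r)
      = (\<Sum>r\<le>n. k r n * u r)" for n
    by (simp add: k_def sum_distrib_left mult.assoc)
  from assms have "(\<lambda>n. \<Sum>r\<le>n. k r n * u r) \<longlonglongrightarrow> rGamma (1 + a - b - c) * (\<Sum>r. u r)"
  proof (elim disjE exE conjE)
    fix N assume N: "\<forall>r\<ge>N. u r = 0"
    have "(\<lambda>n. \<Sum>r<N. k r n * u r) \<longlonglongrightarrow> (\<Sum>r<N. rGamma (1 + a - b - c) * u r)"
      by (intro tendsto_intros k)
    moreover have "(\<Sum>r. u r) = (\<Sum>r<N. u r)" by (rule suminf_finite) (use N in auto)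
    moreover have "\<forall>\<^sub>F n in sequentially. (\<Sum>r<N. k r n * u r) = (\<Sum>r\<le>n. k r n * u r)"
      using eventually_ge_at_top[of N]
    proof eventually_elim
      case (elim n)
      show ?case by (rule sum.mono_neutral_left) (use elim N in auto)
    qed
    ultimately show ?thesis by (simp add: tendsto_cong sum_distrib_left)
  next
    assume d: "Re (1 + a - b - c) \<ge> 1" and u: "summable (\<lambda>r. norm (u r))"
    obtain C where C: "\<forall>\<^sub>F n in sequentially. \<forall>r\<le>n. norm (k r n) \<le> C"
      using bailey_kernel_bounded[OF d] unfolding k_def by blast
    define f where "f = (\<lambda>r n. if r \<le> n then k r n * u r else 0)"
    have "f r \<longlonglongrightarrow> rGamma (1 + a - b - c) * u r" for r
    proof -
      have "(\<lambda>n. k r n * u r) \<longlonglongrightarrow> rGamma (1 + a - b - c) * u r" by (intro tendsto_intros k)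
      moreover have "\<forall>\<^sub>F n in sequentially. k r n * u r = f r n"
        using eventually_ge_at_top[of r] by eventually_elim (simp add: f_def)
      ultimately show ?thesis by (simp add: tendsto_cong)
    qed
    moreover have "\<forall>\<^sub>F (r, n) in at_top \<times>\<^sub>F at_top. norm (f r n) \<le> \<bar>C\<bar> * norm (u r)"
    proof -
      from C have "\<forall>\<^sub>F n in sequentially. \<forall>r. norm (f r n) \<le> \<bar>C\<bar> * norm (u r)"
      proof eventually_elim
        case (elim n)
        show ?case
        proof
          fix r
          have "r \<le> n \<Longrightarrow> norm (k r n) \<le> \<bar>C\<bar>" using elim by fastforce
          then show "norm (f r n) \<le> \<bar>C\<bar> * norm (u r)"
            by (auto simp: f_def norm_mult intro!: mult_right_mono)
        qed
      qed
      then show ?thesis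
        unfolding eventually_prod_filter
        by (intro exI[of _ "\<lambda>_. True"] exI[of _ "\<lambda>n. \<forall>r. norm (f r n) \<le> \<bar>C\<bar> * norm (u r)"]) auto
    qed
    ultimately have "(\<lambda>n. \<Sum>r. f r n) \<longlonglongrightarrow> (\<Sum>r. rGamma (1 + a - b - c) * u r)"
      using tannerys_theorem[of f "\<lambda>r. rGamma (1 + a - b - c) * u r" sequentially "\<lambda>r. \<bar>C\<bar> * norm (u r)"]
        summable_mult[OF u, of "\<bar>C\<bar>"] by auto
    moreover have "(\<Sum>r. f r n) = (\<Sum>r\<le>n. k r n * u r)" for n
    proof -
      have "(\<Sum>r. f r n) = (\<Sum>r\<le>n. f r n)" by (rule suminf_finite) (auto simp: f_def)
      then show ?thesis by (simp add: f_def)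
    qed
    ultimately show ?thesis
      by (simp add: suminf_mult[OF summable_norm_cancel[OF u]])
  qed
  then show ?thesis by (simp only: eq)
qed

section \<open>Truncation at \<open>n\<close> as a convergence factor\<close>

definition cutoff :: "complex \<Rightarrow> nat \<Rightarrow> nat \<Rightarrow> complex" where
  "cutoff z n r = (\<Prod>i<r. (of_nat n - of_nat i) / (z + of_nat n + of_nat i))"

lemma cutoff_eq_0: "r > n \<Longrightarrow> cutoff z n r = 0"
  unfolding cutoff_def by (rule prod_zero) auto

text \<open>The product is \<open>(-1)^r * pochhammer (- n) r / pochhammer (z + n) r\<close>. With
  \<open>z = 1 + a\<close> this form identifies it with the coefficients in
  \<open>bailey_beta\<close>, normalised to 1 at \<open>r = 0\<close>; the condition on
  \<open>Re z\<close> keeps the denominators away from 0.\<close>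

lemma cutoff_eq:
  assumes "Re z + real n > 0" and "r \<le> n"
  shows "cutoff z n r = fact n / fact (n - r) * (rGamma (z + of_nat n + of_nat r) / rGamma (z + of_nat n))"
  using assms(2)
proof (induction r)
  case 0
  have "z + of_nat n \<notin> \<int>\<^sub>\<le>\<^sub>0" using assms nonpos_Ints_complex_Re[of "z + of_nat n"] by auto
  then show ?case by (simp add: cutoff_def rGamma_eq_zero_iff)
next
  case (Suc r)
  then obtain k where n: "n = Suc (r + k)" using less_imp_Suc_add by (metis Suc_le_lessD)
  have nz: "z + of_nat n + of_nat r \<noteq> 0" using assms(1) by (auto simp: complex_eq_iff)
  have R: "rGamma (z + of_nat n + of_nat r) = (z + of_nat n + of_nat r) * rGamma (z + of_nat n + of_nat (Suc r))"
    using rGamma_plus1[of "z + of_nat n + of_nat r"] by (simp add: add_ac)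
  have "cutoff z n (Suc r) = cutoff z n r * ((of_nat n - of_nat r) / (z + of_nat n + of_nat r))"
    by (simp add: cutoff_def)
  also have "cutoff z n r = fact n / fact (n - r) * (rGamma (z + of_nat n + of_nat r) / rGamma (z + of_nat n))"
    using Suc by simp
  also have "fact n / fact (n - r) = fact n / ((of_nat n - of_nat r) * (fact (n - Suc r) :: complex))"
    by (simp add: n algebra_simps)
  also have "fact n / ((of_nat n - of_nat r) * fact (n - Suc r)) * (rGamma (z + of_nat n + of_nat r) / rGamma (z + of_nat n))
        * ((of_nat n - of_nat r) / (z + of_nat n + of_nat r))
      = fact n / fact (n - Suc r) * (rGamma (z + of_nat n + of_nat (Suc r)) / rGamma (z + of_nat n))"
  proof -
    have "of_nat n - of_nat r \<noteq> (0 :: complex)"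
      using n of_nat_neq_0[of k, where ?'a = complex] by (simp del: of_nat_Suc)
    then show ?thesis unfolding R using nz by simp
  qed
  finally show ?case .
qed

lemma cutoff_tendsto_1: "(\<lambda>n. cutoff z n r) \<longlonglongrightarrow> 1"
proof -
  have "(\<lambda>n. (of_nat n - of_nat i) / (z + of_nat n + of_nat i)) \<longlonglongrightarrow> 1" for i
  proof -
    have "(\<lambda>n. ((- of_nat i + of_nat n) / of_nat n) / ((z + of_nat i + of_nat n) / of_nat n)) \<longlonglongrightarrow> 1 / (1 :: complex)"
      by (intro tendsto_divide tendsto_add_over_of_nat) auto
    moreover have "\<forall>\<^sub>F n in sequentially. ((- of_nat i + of_nat n) / of_nat n) / ((z + of_nat i + of_nat n) / of_nat n)
        = (of_nat n - of_nat i) / (z + of_nat n + of_nat i)"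
      using eventually_gt_at_top[of 0] by eventually_elim (simp add: add_ac)
    ultimately show ?thesis by (simp add: tendsto_cong)
  qed
  then have "(\<lambda>n. cutoff z n r) \<longlonglongrightarrow> (\<Prod>i<r. 1)"
    unfolding cutoff_def by (intro tendsto_prod)
  then show ?thesis by simp
qed

text \<open>For real \<open>z\<close> the values eventually decrease in \<open>r\<close>, so their
  variation telescopes. For complex \<open>z\<close> they are compared with the product
  \<open>V\<close> formed with \<open>Re z\<close>: from the index \<open>m\<close> on the
  increments are at most \<open>K\<close> times the decrements of \<open>V\<close>, and the first
  \<open>m\<close> are bounded crudely.\<close>

lemma cutoff_variation:
  obtains V where "\<forall>\<^sub>F n in sequentially. \<forall>N. (\<Sum>r<N. norm (cutoff z n (Suc r) - cutoff z n r)) \<le> V"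
proof -
  define x where "x = Re z"
  \<comment> \<open>This bounds \<open>norm (z + 2 * r) / (x + 2 * r)\<close> as soon as
    \<open>x + 2 * r \<ge> 1\<close>, which \<open>m\<close> below guarantees for
    \<open>r \<ge> m\<close>.\<close>
  define K where "K = 1 + \<bar>Im z\<bar>"
  obtain m :: nat where m: "x + 2 * real m \<ge> 1"
  proof -
    obtain m :: nat where "1 - x \<le> real m" using real_arch_simple by blast
    then show ?thesis using that[of m] by simp
  qed
  have "(\<Sum>r<N. norm (cutoff z n (Suc r) - cutoff z n r)) \<le> real m * 2 ^ (m + 1) + K * 2 ^ m"
    if n: "real n \<ge> 2 * \<bar>x\<bar> + 1" for n N
  proof -
    \<comment> \<open>The lower bound on \<open>n\<close> makes the denominators positive and every
      factor at most 2. The \<open>max 0\<close> keeps the factors beyond \<open>i = n\<close>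
      nonnegative, where the product is 0 anyway.\<close>
    define V where "V = (\<lambda>r. \<Prod>i<r. max 0 (real n - real i) / (x + real n + real i))"
    have pos: "x + real n + real i > 0" for i using n by linarith
    have V0: "V r \<ge> 0" for r unfolding V_def using pos by (intro prod_nonneg) (auto simp: less_imp_le)
    have V2: "V r \<le> 2 ^ r" for r
    proof -
      have "V r \<le> (\<Prod>i<r. 2)"
        unfolding V_def
      proof (intro prod_mono conjI)
        fix i
        show "0 \<le> max 0 (real n - real i) / (x + real n + real i)"
          using pos[of i] by simp
        have "real n - real i \<le> 2 * (x + real n + real i)" using n by (simp add: abs_if split: if_splits)
        then have "max 0 (real n - real i) \<le> 2 * (x + real n + real i)" using pos[of i] by simp
        then show "max 0 (real n - real i) / (x + real n + real i) \<le> 2"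
          using pos[of i] by (simp add: divide_le_eq)
      qed
      then show ?thesis by simp
    qed
    have den: "norm (z + of_nat n + of_nat i) \<ge> x + real n + real i" for i
      using complex_Re_le_cmod[of "z + of_nat n + of_nat i"] by (simp add: x_def)
    have WV: "norm (cutoff z n r) \<le> V r" for r
    proof (cases "r \<le> n")
      case True
      then show ?thesis
        unfolding cutoff_def V_def prod_norm[symmetric]
      proof (intro prod_mono conjI norm_ge_zero)
        fix i assume "i \<in> {..<r}"
        then have "norm (of_nat n - of_nat i :: complex) = max 0 (real n - real i)"
          using True by (simp flip: of_nat_diff)
        then show "norm ((of_nat n - of_nat i) / (z + of_nat n + of_nat i)) \<le> max 0 (real n - real i) / (x + real n + real i)"
          unfolding norm_divide using den[of i] pos[of i] by (intro frac_le) auto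
      qed
    qed (simp add: cutoff_eq_0 V0)
    have small: "norm (cutoff z n (Suc r) - cutoff z n r) \<le> 2 ^ (m + 1)" if "r < m" for r
    proof -
      have "norm (cutoff z n (Suc r) - cutoff z n r) \<le> 2 ^ Suc r + 2 ^ r"
        using norm_triangle_ineq4[of "cutoff z n (Suc r)" "cutoff z n r"]
          WV[of r] WV[of "Suc r"] V2[of r] V2[of "Suc r"] by linarith
      also have "\<dots> \<le> 2 ^ m + 2 ^ m"
        using that by (intro add_mono power_increasing) auto
      finally show ?thesis by simp
    qed
    have large: "norm (cutoff z n (Suc r) - cutoff z n r) \<le> K * (V r - V (Suc r))" if "r \<ge> m" for r
    proof (cases "r \<le> n")
      case True
      have nz: "z + of_nat n + of_nat r \<noteq> 0" using den[of r] pos[of r] by auto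
      have "cutoff z n (Suc r) - cutoff z n r
          = cutoff z n r * ((of_nat n - of_nat r) / (z + of_nat n + of_nat r) - 1)"
        by (simp add: cutoff_def right_diff_distrib)
      also have "(of_nat n - of_nat r) / (z + of_nat n + of_nat r) - 1
          = - ((z + 2 * of_nat r) / (z + of_nat n + of_nat r))"
        using nz by (simp add: field_simps)
      finally have "norm (cutoff z n (Suc r) - cutoff z n r)
          = norm (cutoff z n r) * (norm (z + 2 * of_nat r) / norm (z + of_nat n + of_nat r))"
        by (simp add: norm_mult norm_divide)
      also have "\<dots> \<le> V r * (K * (x + 2 * real r) / (x + real n + real r))"
      proof (intro mult_mono frac_le WV V0)
        have x1: "x + 2 * real r \<ge> 1" using m that by linarith
        have "norm (z + 2 * of_nat r) \<le> \<bar>x + 2 * real r\<bar> + \<bar>Im z\<bar>"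
          using cmod_le[of "z + 2 * of_nat r"] by (simp add: x_def)
        also have "\<dots> \<le> K * (x + 2 * real r)"
          using x1 mult_left_mono[OF x1, of "\<bar>Im z\<bar>"] by (simp add: K_def algebra_simps)
        finally show "norm (z + 2 * of_nat r) \<le> K * (x + 2 * real r)" .
        show "0 \<le> K * (x + 2 * real r)" using x1 by (simp add: K_def)
      qed (use pos den in auto)
      also have "\<dots> = K * (V r - V (Suc r))"
      proof -
        have "V (Suc r) = V r * ((real n - real r) / (x + real n + real r))"
          using True by (simp add: V_def)
        moreover have "1 - (real n - real r) / (x + real n + real r) = (x + 2 * real r) / (x + real n + real r)"
          using pos[of r] by (simp add: field_simps)
        ultimately have "V r - V (Suc r) = V r * ((x + 2 * real r) / (x + real n + real r))"
          by (metis mult.right_neutral right_diff_distrib)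
        then show ?thesis by simp
      qed
      finally show ?thesis .
    next
      case False
      then have "V r = 0" "V (Suc r) = 0"
        unfolding V_def by (auto intro!: prod_zero bexI[of _ n])
      with False show ?thesis by (simp add: cutoff_eq_0)
    qed
    have part: "(\<Sum>r<m + k. norm (cutoff z n (Suc r) - cutoff z n r)) \<le> real m * 2 ^ (m + 1) + K * (V m - V (m + k))" for k
    proof (induction k)
      case 0
      show ?case
        using sum_bounded_above[of "{..<m}" "\<lambda>r. norm (cutoff z n (Suc r) - cutoff z n r)" "2 ^ (m + 1)"] small by simp
    next
      case (Suc k)
      then show ?case using large[of "m + k"] by (simp add: algebra_simps)
    qed
    have "(\<Sum>r<N. norm (cutoff z n (Suc r) - cutoff z n r)) \<le> (\<Sum>r<m + N. norm (cutoff z n (Suc r) - cutoff z n r))"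
      by (intro sum_mono2) auto
    also have "\<dots> \<le> real m * 2 ^ (m + 1) + K * (V m - V (m + N))" by (rule part)
    also have "\<dots> \<le> real m * 2 ^ (m + 1) + K * 2 ^ m"
      using V0[of "m + N"] V2[of m] by (intro add_left_mono mult_left_mono) (auto simp: K_def)
    finally show ?thesis .
  qed
  then have "\<forall>\<^sub>F n in sequentially. \<forall>N. (\<Sum>r<N. norm (cutoff z n (Suc r) - cutoff z n r)) \<le> real m * 2 ^ (m + 1) + K * 2 ^ m"
    using filterlim_real_sequentially unfolding filterlim_at_top
    by (auto elim!: eventually_mono allE[of _ "2 * \<bar>x\<bar> + 1"])
  then show ?thesis by (rule that)
qed

text \<open>The finite identity at \<open>n\<close>, suitably normalised, has on its \<alpha> side
  the given series with the factors \<open>cutoff (1 + a) n\<close>. Both sides converge, by bounded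
  variation and by \<open>bailey_rhs_limit\<close>, and the limits must agree.\<close>

lemma bailey_lemma_restricted:
  assumes lhs: "(\<lambda>r. \<alpha> r * bailey_weight a b c r) sums S"
    and rhs: "(\<exists>N. \<forall>r\<ge>N. pochhammer b r * pochhammer c r * bailey_beta a \<alpha> r = 0)
      \<or> Re (1 + a - b - c) \<ge> 1 \<and> summable (\<lambda>r. norm (pochhammer b r * pochhammer c r * bailey_beta a \<alpha> r))"
  shows "S = rGamma (1 + a - b - c) * (\<Sum>r. pochhammer b r * pochhammer c r * bailey_beta a \<alpha> r)"
proof -
  define u where "u = (\<lambda>r. pochhammer b r * pochhammer c r * bailey_beta a \<alpha> r)"
  define A where "A = (\<lambda>r. \<alpha> r * bailey_weight a b c r)"
  define Q where "Q = (\<lambda>n. bailey_factor a b c n * (\<Sum>r\<le>n. pochhammer (1 + a - b - c) (n - r) / fact (n - r) * u r))"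
  have "Q \<longlonglongrightarrow> rGamma (1 + a - b - c) * (\<Sum>r. u r)"
    unfolding Q_def by (rule bailey_rhs_limit) (use rhs in \<open>simp add: u_def\<close>)
  moreover have "(\<lambda>n. \<Sum>r. A r * cutoff (1 + a) n r) \<longlonglongrightarrow> S"
  proof -
    obtain V where "\<forall>\<^sub>F n in sequentially. \<forall>N. (\<Sum>r<N. norm (cutoff (1 + a) n (Suc r) - cutoff (1 + a) n r)) \<le> V"
      using cutoff_variation by blast
    then show ?thesis
      using lhs unfolding A_def by (intro tendsto_suminf_bounded_variation cutoff_tendsto_1)
  qed
  moreover have "\<forall>\<^sub>F n in sequentially. Q n = (\<Sum>r. A r * cutoff (1 + a) n r)"
  proof -
    have "\<forall>\<^sub>F n in sequentially. 1 - Re (1 + a) \<le> real n"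
      using filterlim_real_sequentially unfolding filterlim_at_top by blast
    then show ?thesis
    proof eventually_elim
      case (elim n)
      then have n: "Re (1 + a) + real n > 0" by linarith
      have "(\<Sum>r. A r * cutoff (1 + a) n r) = (\<Sum>r\<le>n. A r * cutoff (1 + a) n r)"
        by (rule suminf_finite) (auto simp: cutoff_eq_0)
      also have "\<dots> = fact n / rGamma (1 + a + of_nat n) * bailey_beta a A n"
        unfolding bailey_beta_def sum_distrib_left
        by (intro sum.cong refl) (simp add: cutoff_eq[OF n] mult_ac)
      also have "\<dots> = Q n"
        unfolding A_def bailey_lemma_finite[symmetric] Q_def bailey_factor_def u_def
        by (simp add: sum_distrib_left sum_distrib_right sum_divide_distrib mult_ac)
      finally show ?case ..
    qed
  qed
  ultimately have "S = rGamma (1 + a - b - c) * (\<Sum>r. u r)"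
    using LIMSEQ_unique tendsto_cong by metis
  then show ?thesis by (simp add: u_def)
qed

section \<open>The full Bailey lemma and the multiple sum\<close>

text \<open>Absolute convergence of the \<beta> side replaces the bound on
  \<open>Re (1 + a - b - c)\<close>: the identity is continued analytically in the shift
  \<open>t\<close> and then taken to the boundary point \<open>t = 0\<close>.\<close>

lemma bailey_lemma:
  assumes lhs: "(\<lambda>r. \<alpha> r * bailey_weight a b c r) sums S"
    and u: "summable (\<lambda>r. norm (pochhammer b r * pochhammer c r * bailey_beta a \<alpha> r))"
    and e: "1 + a - c \<notin> \<int>\<^sub>\<le>\<^sub>0"
  shows "S = rGamma (1 + a - b - c) * (\<Sum>r. pochhammer b r * pochhammer c r * bailey_beta a \<alpha> r)"
proof (cases "c \<in> \<int>\<^sub>\<le>\<^sub>0")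
  case True
  \<comment> \<open>Here division by \<open>pochhammer c r\<close> would fail, but the \<beta> side
    terminates.\<close>
  then obtain k where "c = - of_nat k" by (elim nonpos_Ints_cases')
  then have "pochhammer c r = 0" if "r \<ge> Suc k" for r
    using that by (auto simp: pochhammer_of_nat_eq_0_iff)
  then show ?thesis
    by (intro bailey_lemma_restricted lhs disjI1 exI[of _ "Suc k"]) auto
next
  case c: False
  define d where "d = 1 + a - b - c"
  define e where "e = 1 + a - c"
  define U where "U = {t. Re t > 0}"
  have eN: "e \<notin> \<int>\<^sub>\<le>\<^sub>0" using assms(3) by (simp add: e_def)
  define v where "v = (\<lambda>r. pochhammer b r * pochhammer c r * bailey_beta a \<alpha> r)"
  obtain L1 where L1: "L1 holomorphic_on U"
    "\<And>t. Re t > 0 \<Longrightarrow> (\<lambda>r. \<alpha> r * bailey_weight a b c r * (pochhammer (c - t) r / pochhammer c r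
           * (rGamma (e + t + of_nat r) / rGamma (e + of_nat r)))) sums L1 t"
    "((\<lambda>x. L1 (of_real x)) \<longlongrightarrow> S) (at_right 0)"
    by (rule damped_series_rGamma[OF c eN lhs, folded U_def]) (rule that)
  have u': "summable (\<lambda>r. norm (v r))" using u by (simp add: v_def)
  obtain L2 where L2: "L2 holomorphic_on U"
    "\<And>t. Re t > 0 \<Longrightarrow> summable (\<lambda>r. norm (v r * (pochhammer (c - t) r / pochhammer c r)))"
    "\<And>t. Re t > 0 \<Longrightarrow> (\<lambda>r. v r * (pochhammer (c - t) r / pochhammer c r)) sums L2 t"
    "((\<lambda>x. L2 (of_real x)) \<longlongrightarrow> (\<Sum>r. v r)) (at_right 0)"
    by (rule shifted_series[OF c u', folded U_def]) (rule that)
  have eq1: "\<alpha> r * bailey_weight a b c r * (pochhammer (c - t) r / pochhammer c r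
           * (rGamma (e + t + of_nat r) / rGamma (e + of_nat r)))
      = \<alpha> r * bailey_weight a b (c - t) r" for r t
  proof -
    have "rGamma (e + of_nat r) \<noteq> 0"
      using pochhammer_rGamma[of e r] rGamma_eq_zero_iff[of e] eN by (metis mult_zero_right)
    moreover have et: "1 + a - (c - t) = e + t" by (simp add: e_def)
    ultimately show ?thesis
      using pochhammer_neq_0[OF c, of r] unfolding bailey_weight_def et e_def[symmetric] by simp
  qed
  have eq2: "v r * (pochhammer (c - t) r / pochhammer c r)
      = pochhammer b r * pochhammer (c - t) r * bailey_beta a \<alpha> r" for r t
    using pochhammer_neq_0[OF c, of r] by (simp add: v_def)
  \<comment> \<open>Beyond \<open>M\<close> the shifted parameter satisfies
    \<open>Re (d + t) \<ge> 1\<close>, as \<open>bailey_lemma_restricted\<close> requires.\<close>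
  define M where "M = max 0 (1 - Re d)"
  have far: "L1 t = rGamma (d + t) * L2 t" if "t \<in> {t. Re t > M}" for t
  proof -
    have t: "Re t > 0" "Re (d + t) \<ge> 1" using that by (auto simp: M_def)
    have dt: "1 + a - b - (c - t) = d + t" by (simp add: d_def)
    have "L1 t = rGamma (1 + a - b - (c - t)) * (\<Sum>r. pochhammer b r * pochhammer (c - t) r * bailey_beta a \<alpha> r)"
      using L1(2)[OF t(1)] L2(2)[OF t(1)] t(2) unfolding eq1 eq2
      by (intro bailey_lemma_restricted disjI2) (auto simp: dt)
    also have "(\<Sum>r. pochhammer b r * pochhammer (c - t) r * bailey_beta a \<alpha> r) = L2 t"
      using L2(3)[OF t(1)] unfolding eq2 by (simp add: sums_iff)
    finally show ?thesis by (simp only: dt)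
  qed
  \<comment> \<open>Identity theorem on the connected half-plane, starting from the smaller
    half-plane of \<open>far\<close>.\<close>
  have near: "L1 t = rGamma (d + t) * L2 t" if "t \<in> U" for t
  proof (rule analytic_continuation_open[where s = "{t. Re t > M}" and s' = U and f = L1 and g = "\<lambda>t. rGamma (d + t) * L2 t"])
    show "open {t. Re t > M}" "open U" by (simp_all add: U_def open_halfspace_Re_gt)
    have "of_real (M + 1) \<in> {t. Re t > M}" by simp
    then show "{t. Re t > M} \<noteq> {}" by blast
    show "connected U" unfolding U_def by (intro convex_connected convex_halfspace_Re_gt)
    show "{t. Re t > M} \<subseteq> U" by (auto simp: U_def M_def)
    show "(\<lambda>t. rGamma (d + t) * L2 t) holomorphic_on U" by (intro holomorphic_intros L2(1))
  qed (use L1(1) far that in auto)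
  have "((\<lambda>x. rGamma (d + of_real x) * L2 (of_real x)) \<longlongrightarrow> rGamma (d + of_real 0) * (\<Sum>r. v r)) (at_right 0)"
    by (intro tendsto_intros L2(4) isCont_tendsto_compose[OF isCont_rGamma[OF continuous_ident]])
  moreover have "\<forall>\<^sub>F x in at_right (0::real). rGamma (d + of_real x) * L2 (of_real x) = L1 (of_real x)"
    using eventually_at_right_less[of 0] by eventually_elim (simp add: near U_def)
  ultimately have "((\<lambda>x. L1 (of_real x)) \<longlongrightarrow> rGamma d * (\<Sum>r. v r)) (at_right 0)"
    by (simp add: tendsto_cong)
  with L1(3) have "S = rGamma d * (\<Sum>r. v r)"
    by (rule tendsto_unique[OF trivial_limit_at_right_real])
  then show ?thesis by (simp add: d_def v_def)
qed

section \<open>Iterated Bailey pairs and the multiple sum by levels\<close>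

definition vwp_alpha :: "nat \<Rightarrow> complex \<Rightarrow> (nat \<Rightarrow> complex) \<Rightarrow> (nat \<Rightarrow> complex) \<Rightarrow> nat \<Rightarrow> complex" where
  "vwp_alpha s a b c n = unit_alpha a n * (\<Prod>j=1..s. pochhammer (b j) n * pochhammer (c j) n
     / (pochhammer (1 + a - b j) n * pochhammer (1 + a - c j) n))"

definition level_indices :: "nat \<Rightarrow> nat \<Rightarrow> (nat \<Rightarrow> nat) set" where
  "level_indices s n = {k \<in> multi_indices s. sum k {1..s} = n}"

definition level_sum :: "nat \<Rightarrow> complex \<Rightarrow> (nat \<Rightarrow> complex) \<Rightarrow> (nat \<Rightarrow> complex) \<Rightarrow> nat \<Rightarrow> complex" where
  "level_sum s a b c n = (\<Sum>k\<in>level_indices s n. multisum_term s a b c k)"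

lemma finite_level_indices: "finite (level_indices s n)"
proof (rule finite_subset)
  show "level_indices s n \<subseteq> {1..s} \<rightarrow>\<^sub>E {..n}"
    by (auto simp: level_indices_def multi_indices_def PiE_iff extensional_def intro: member_le_sum)
qed (intro finite_PiE, auto)

lemma multisum_term_cong:
  assumes "\<And>j. 1 \<le> j \<Longrightarrow> j \<le> s \<Longrightarrow> k j = k' j"
  shows "multisum_term s a b c k = multisum_term s a b c k'"
proof -
  have "(\<Sum>i=1..j. k i) = (\<Sum>i=1..j. k' i)" if "j \<le> s" for j
    using that assms by (intro sum.cong) auto
  then show ?thesis
    unfolding multisum_term_def using assms by (intro prod.cong refl) auto
qed

text \<open>The last coordinate is \<open>n - r\<close>, where \<open>r\<close> is the level of the
  first \<open>s\<close> coordinates, and the last factor of the summand depends on \<open>r\<close>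
  and \<open>n\<close> only.\<close>

lemma level_sum_Suc:
  "level_sum (Suc s) a b c n = (\<Sum>r\<le>n. pochhammer (1 + a - b (Suc s) - c (Suc s)) (n - r)
      * pochhammer (b (Suc (Suc s))) n * pochhammer (c (Suc (Suc s))) n
      / (fact (n - r) * pochhammer (1 + a - b (Suc s)) n * pochhammer (1 + a - c (Suc s)) n) * level_sum s a b c r)"
proof -
  define F where "F = (\<lambda>r. pochhammer (1 + a - b (Suc s) - c (Suc s)) (n - r)
      * pochhammer (b (Suc (Suc s))) n * pochhammer (c (Suc (Suc s))) n
      / (fact (n - r) * pochhammer (1 + a - b (Suc s)) n * pochhammer (1 + a - c (Suc s)) n))"
  have "(\<Sum>r\<le>n. F r * level_sum s a b c r)
      = (\<Sum>(r, g)\<in>(SIGMA r:{..n}. level_indices s r). F r * multisum_term s a b c g)"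
    by (simp add: level_sum_def sum_distrib_left sum.Sigma finite_level_indices)
  also have "\<dots> = (\<Sum>k\<in>level_indices (Suc s) n. multisum_term (Suc s) a b c k)"
  proof (rule sum.reindex_bij_witness[of _ "\<lambda>k. (sum k {1..s}, restrict k {1..s})" "\<lambda>(r, g). g(Suc s := n - r)"])
    fix x assume "x \<in> (SIGMA r:{..n}. level_indices s r)"
    then obtain r g where x: "x = (r, g)" "r \<le> n" "g \<in> {1..s} \<rightarrow>\<^sub>E UNIV" "sum g {1..s} = r"
      by (auto simp: level_indices_def multi_indices_def)
    have sg: "sum (g(Suc s := y)) {1..j} = sum g {1..j}" if "j \<le> s" for y j
      using that by (intro sum.cong) auto
    have rg: "restrict (g(Suc s := y)) {1..s} = g" for y
      using x(3) by (auto simp: restrict_def PiE_iff extensional_def)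
    show "(sum (case x of (r, g) \<Rightarrow> g(Suc s := n - r)) {1..s}, restrict (case x of (r, g) \<Rightarrow> g(Suc s := n - r)) {1..s}) = x"
      using sg[of s] rg x by simp
    have s1: "sum (g(Suc s := n - r)) {1..Suc s} = n"
      using sg[of s] x by (simp add: sum.nat_ivl_Suc')
    show "(case x of (r, g) \<Rightarrow> g(Suc s := n - r)) \<in> level_indices (Suc s) n"
      using x s1 by (auto simp: level_indices_def multi_indices_def PiE_iff extensional_def)
    have "multisum_term (Suc s) a b c (g(Suc s := n - r)) = multisum_term s a b c (g(Suc s := n - r)) * F r"
      unfolding multisum_term_def using s1 by (simp add: prod.nat_ivl_Suc' F_def mult_ac)
    also have "multisum_term s a b c (g(Suc s := n - r)) = multisum_term s a b c g"
      by (rule multisum_term_cong) auto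
    finally show "multisum_term (Suc s) a b c (case x of (r, g) \<Rightarrow> g(Suc s := n - r))
        = (case x of (r, g) \<Rightarrow> F r * multisum_term s a b c g)"
      unfolding x(1) prod.case mult.commute[of "F r"] .
  next
    fix k assume "k \<in> level_indices (Suc s) n"
    then have k: "k \<in> {1..Suc s} \<rightarrow>\<^sub>E UNIV" "sum k {1..s} + k (Suc s) = n"
      by (auto simp: level_indices_def multi_indices_def sum.nat_ivl_Suc')
    show "(case (sum k {1..s}, restrict k {1..s}) of (r, g) \<Rightarrow> g(Suc s := n - r)) = k"
      using k by (auto simp: fun_eq_iff PiE_iff extensional_def)
    show "(sum k {1..s}, restrict k {1..s}) \<in> (SIGMA r:{..n}. level_indices s r)"
      using k by (auto simp: level_indices_def multi_indices_def)
  qed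
  finally show ?thesis by (simp add: level_sum_def F_def)
qed

lemma bailey_beta_divide: "bailey_beta a (\<lambda>r. \<alpha> r / K) n = bailey_beta a \<alpha> n / K"
  by (simp add: bailey_beta_def sum_divide_distrib mult.commute)

lemma bailey_weight_eq:
  assumes "1 + a - b \<notin> \<int>\<^sub>\<le>\<^sub>0" and "1 + a - c \<notin> \<int>\<^sub>\<le>\<^sub>0"
  shows "bailey_weight a b c r = pochhammer b r * pochhammer c r
     / (pochhammer (1 + a - b) r * pochhammer (1 + a - c) r) * (rGamma (1 + a - b) * rGamma (1 + a - c))"
  unfolding bailey_weight_def assms[THEN rGamma_eq_over_pochhammer] by simp

lemma vwp_alpha_Suc:
  assumes "1 + a - b (Suc s) \<notin> \<int>\<^sub>\<le>\<^sub>0" and "1 + a - c (Suc s) \<notin> \<int>\<^sub>\<le>\<^sub>0"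
  shows "vwp_alpha (Suc s) a b c n * (rGamma (1 + a - b (Suc s)) * rGamma (1 + a - c (Suc s)))
     = vwp_alpha s a b c n * bailey_weight a (b (Suc s)) (c (Suc s)) n"
  unfolding vwp_alpha_def bailey_weight_eq[OF assms] by (simp add: prod.nat_ivl_Suc' mult_ac)

text \<open>Induction on \<open>s\<close>: \<open>bailey_lemma_finite\<close> gives \<beta> the same
  recurrence as \<open>level_sum_Suc\<close>. The Pochhammer symbols on the left belong to the next
  pair of parameters, which the last factor of \<open>multisum_term\<close> already
  contains.\<close>

lemma bailey_beta_vwp:
  assumes a: "a / 2 \<notin> \<int>\<^sub>\<le>\<^sub>0"
    and bc: "\<And>j. 1 \<le> j \<Longrightarrow> j \<le> s \<Longrightarrow> 1 + a - b j \<notin> \<int>\<^sub>\<le>\<^sub>0 \<and> 1 + a - c j \<notin> \<int>\<^sub>\<le>\<^sub>0"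
  shows "pochhammer (b (Suc s)) n * pochhammer (c (Suc s)) n * bailey_beta a (vwp_alpha s a b c) n
           = rGamma (1 + a) * level_sum s a b c n"
  using bc
proof (induction s arbitrary: n)
  case 0
  have "vwp_alpha 0 a b c = unit_alpha a" by (simp add: vwp_alpha_def fun_eq_iff)
  moreover have "level_indices 0 n = (if n = 0 then {\<lambda>_. undefined} else {})"
    by (auto simp: level_indices_def multi_indices_def)
  ultimately show ?case
    by (simp add: bailey_beta_unit[OF a] level_sum_def multisum_term_def)
next
  case (Suc s)
  define B C where "B = b (Suc s)" "C = c (Suc s)"
  have BC: "1 + a - B \<notin> \<int>\<^sub>\<le>\<^sub>0" "1 + a - C \<notin> \<int>\<^sub>\<le>\<^sub>0"
    using Suc.prems[of "Suc s"] by (simp_all add: B_C_def)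
  define K where "K = rGamma (1 + a - B) * rGamma (1 + a - C)"
  have K: "K \<noteq> 0" using BC by (simp add: K_def rGamma_eq_zero_iff)
  define \<beta> where "\<beta> = bailey_beta a (vwp_alpha s a b c)"
  define R where "R = pochhammer (1 + a - B) n * pochhammer (1 + a - C) n"
  have IH: "pochhammer B r * pochhammer C r * \<beta> r = rGamma (1 + a) * level_sum s a b c r" for r
    using Suc.IH Suc.prems by (simp add: B_C_def \<beta>_def)
  have "vwp_alpha (Suc s) a b c = (\<lambda>r. vwp_alpha s a b c r * bailey_weight a B C r / K)"
    using K vwp_alpha_Suc[of a b s c] BC
    by (simp add: fun_eq_iff K_def B_C_def nonzero_eq_divide_eq)
  then have "bailey_beta a (vwp_alpha (Suc s) a b c) n
      = (\<Sum>j\<le>n. pochhammer B j * pochhammer C j * pochhammer (1 + a - B - C) (n - j) / fact (n - j) * \<beta> j)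
          * rGamma (1 + a - B + of_nat n) * rGamma (1 + a - C + of_nat n) / K"
    unfolding \<beta>_def bailey_lemma_finite by (simp only: bailey_beta_divide)
  also have "\<dots> = (\<Sum>j\<le>n. pochhammer B j * pochhammer C j * pochhammer (1 + a - B - C) (n - j) / fact (n - j) * \<beta> j) / R"
    using K unfolding BC[THEN rGamma_eq_over_pochhammer] by (simp add: K_def R_def)
  also have "\<dots> = (\<Sum>j\<le>n. pochhammer (1 + a - B - C) (n - j) / (fact (n - j) * R) * (pochhammer B j * pochhammer C j * \<beta> j))"
    by (simp add: sum_divide_distrib mult_ac)
  also have "\<dots> = rGamma (1 + a) * (\<Sum>j\<le>n. pochhammer (1 + a - B - C) (n - j) / (fact (n - j) * R) * level_sum s a b c j)"
    unfolding IH by (simp add: sum_distrib_left mult_ac)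
  finally show ?case
    unfolding level_sum_Suc B_C_def R_def by (simp add: sum_distrib_left mult_ac)
qed

lemma prod_list_map_concat_pairs:
  fixes f :: "'b \<Rightarrow> 'a::comm_monoid_mult"
  shows "(\<Prod>x\<leftarrow>concat (map (\<lambda>j. [p j, q j]) [1..<s + 2]). f x) = (\<Prod>j=1..Suc s. f (p j) * f (q j))"
proof -
  have "(\<Prod>x\<leftarrow>concat (map (\<lambda>j. [p j, q j]) xs). f x) = (\<Prod>j\<leftarrow>xs. f (p j) * f (q j))" for xs :: "nat list"
    by (induction xs) (auto simp: mult_ac)
  then have "(\<Prod>x\<leftarrow>concat (map (\<lambda>j. [p j, q j]) [1..<s + 2]). f x) = (\<Prod>j\<in>set [1..<s + 2]. f (p j) * f (q j))"
    by (simp only: prod.distinct_set_conv_list distinct_upt)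
  also have "set [1..<s + 2] = {1..Suc s}" by auto
  finally show ?thesis .
qed

lemma hypergeo_term_vwp:
  "hypergeo_term (vwp_upper s a b c) (vwp_lower s a b c) (-1) n = vwp_alpha (Suc s) a b c n"
  unfolding hypergeo_term_def vwp_upper_def vwp_lower_def vwp_alpha_def unit_alpha_def
    map_append prod_list.append prod_list_map_concat_pairs prod_dividef
  by (simp add: mult_ac)

text \<open>Summability over the tuples is unconditional, so they may be regrouped by their sum into
  finite levels.\<close>

lemma multisum_by_levels:
  assumes "multisum_term s a b c summable_on multi_indices s"
  shows "summable (\<lambda>n. norm (level_sum s a b c n))"
    and "(\<Sum>\<^sub>\<infinity>k\<in>multi_indices s. multisum_term s a b c k) = (\<Sum>n. level_sum s a b c n)"
proof -
  define f where "f = multisum_term s a b c"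
  define I where "I = (SIGMA n:(UNIV :: nat set). level_indices s n)"
  have bij: "bij_betw snd I (multi_indices s)"
    by (rule bij_betwI[where g = "\<lambda>k. (sum k {1..s}, k)"]) (auto simp: I_def level_indices_def)
  have "(\<lambda>x. f (snd x)) summable_on I"
    using assms summable_on_reindex_bij_betw[OF bij, of f] by (simp add: f_def)
  then have sI: "(\<lambda>(n, k). f k) summable_on I" by (simp add: case_prod_unfold)
  have lev: "infsum f (level_indices s n) = level_sum s a b c n" for n
    by (simp add: level_sum_def f_def finite_level_indices)
  have "(\<lambda>n. infsum f (level_indices s n)) summable_on UNIV"
    by (rule summable_on_Sigma_banach[OF sI[unfolded I_def]])
  then have so: "level_sum s a b c summable_on UNIV" by (simp add: lev)
  then have "(\<lambda>n. norm (level_sum s a b c n)) summable_on UNIV"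
    by (simp add: summable_on_iff_abs_summable_on_complex)
  then show "summable (\<lambda>n. norm (level_sum s a b c n))" by (rule summable_on_imp_summable)
  have "infsum f (multi_indices s) = (\<Sum>\<^sub>\<infinity>x\<in>I. f (snd x))"
    using infsum_reindex_bij_betw[OF bij, of f] by simp
  also have "\<dots> = (\<Sum>\<^sub>\<infinity>n. infsum f (level_indices s n))"
    using infsum_Sigma'_banach[OF sI[unfolded I_def]] by (simp add: I_def case_prod_unfold)
  also have "\<dots> = (\<Sum>n. level_sum s a b c n)"
    unfolding lev using has_sum_imp_sums[OF has_sum_infsum[OF so]] by (simp add: sums_iff)
  finally show "(\<Sum>\<^sub>\<infinity>k\<in>multi_indices s. multisum_term s a b c k) = (\<Sum>n. level_sum s a b c n)"
    by (simp add: f_def)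
qed

theorem theorem3p6:
  fixes s :: nat and a :: complex and b c :: "nat \<Rightarrow> complex"
  assumes lhs_convergent: "hypergeo_convergent (vwp_upper s a b c) (vwp_lower s a b c) (-1)"
    and rhs_convergent: "multisum_term s a b c summable_on multi_indices s"
  shows "hypergeo (vwp_upper s a b c) (vwp_lower s a b c) (-1) =
           (Gamma (1 + a - b (s+1)) * Gamma (1 + a - c (s+1)))
             / (Gamma (1 + a) * Gamma (1 + a - b (s+1) - c (s+1)))
           * (\<Sum>\<^sub>\<infinity>k\<in>multi_indices s. multisum_term s a b c k)"
proof -
  define B C where "B = b (Suc s)" "C = c (Suc s)"
  have adm: "\<forall>x\<in>set (vwp_lower s a b c). x \<notin> \<int>\<^sub>\<le>\<^sub>0"
    using lhs_convergent by (simp add: hypergeo_convergent_def)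
  then have a: "a / 2 \<notin> \<int>\<^sub>\<le>\<^sub>0" by (simp add: vwp_lower_def)
  have bc: "1 + a - b j \<notin> \<int>\<^sub>\<le>\<^sub>0 \<and> 1 + a - c j \<notin> \<int>\<^sub>\<le>\<^sub>0" if "1 \<le> j" "j \<le> Suc s" for j
  proof -
    have "1 + a - b j \<in> set (vwp_lower s a b c)" "1 + a - c j \<in> set (vwp_lower s a b c)"
      using that by (force simp: vwp_lower_def simp del: upt_Suc)+
    with adm show ?thesis by blast
  qed
  have BC: "1 + a - B \<notin> \<int>\<^sub>\<le>\<^sub>0" "1 + a - C \<notin> \<int>\<^sub>\<le>\<^sub>0"
    using bc[of "Suc s"] by (simp_all add: B_C_def)
  define H where "H = hypergeo (vwp_upper s a b c) (vwp_lower s a b c) (-1)"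
  \<comment> \<open>The constant between the normalisations by Pochhammer symbols and by
    \<open>rGamma\<close>; it is nonzero because the lower parameters are admissible.\<close>
  define K where "K = rGamma (1 + a - B) * rGamma (1 + a - C)"
  have "(\<lambda>n. vwp_alpha (Suc s) a b c n) sums H"
    using lhs_convergent unfolding H_def hypergeo_convergent_def hypergeo_def hypergeo_term_vwp[abs_def]
    by (simp add: summable_sums)
  then have "(\<lambda>n. vwp_alpha (Suc s) a b c n * K) sums (H * K)" by (rule sums_mult2)
  moreover have "vwp_alpha (Suc s) a b c n * K = vwp_alpha s a b c n * bailey_weight a B C n" for n
    using vwp_alpha_Suc[of a b s c] BC by (simp add: K_def B_C_def)
  ultimately have lhs: "(\<lambda>n. vwp_alpha s a b c n * bailey_weight a B C n) sums (H * K)" by simp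
  have u: "pochhammer B n * pochhammer C n * bailey_beta a (vwp_alpha s a b c) n
      = rGamma (1 + a) * level_sum s a b c n" for n
    unfolding B_C_def by (rule bailey_beta_vwp[OF a]) (use bc in auto)
  have "H * K = rGamma (1 + a - B - C) * (\<Sum>n. rGamma (1 + a) * level_sum s a b c n)"
    unfolding u[symmetric]
    by (rule bailey_lemma[OF lhs _ BC(2)])
       (use multisum_by_levels(1)[OF rhs_convergent] in \<open>simp add: u norm_mult summable_mult\<close>)
  also have "(\<Sum>n. rGamma (1 + a) * level_sum s a b c n)
      = rGamma (1 + a) * (\<Sum>\<^sub>\<infinity>k\<in>multi_indices s. multisum_term s a b c k)"
    using suminf_mult[OF summable_norm_cancel[OF multisum_by_levels(1)[OF rhs_convergent]]]
      multisum_by_levels(2)[OF rhs_convergent] by simp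
  finally have "H = (\<Sum>\<^sub>\<infinity>k\<in>multi_indices s. multisum_term s a b c k) * rGamma (1 + a) * rGamma (1 + a - B - C) / K"
    using BC by (simp add: K_def rGamma_eq_zero_iff field_simps)
  \<comment> \<open>\<open>Gamma\<close> takes the value 0 at its poles, so division by it agrees
    with multiplication by \<open>rGamma\<close> there too.\<close>
  then show ?thesis
    by (simp add: H_def K_def B_C_def rGamma_inverse_Gamma field_simps)
qed

end
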